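(* Let $L$ be a $\sigma$-frame and let $f\colon \mathfrak{L}(\overline{\mathbb{R}})\to L$ be a nonnegative measurable extended real function such that $f(r,\text{---})$ is complemented in $L$ for all $r\in\mathbb{Q}$. Suppose that the join of every countable subset of $\{f(r,\text{---})\mid r\in\mathbb{Q}\}$ is complemented in $L$. Then there exist complemented elements $a_1,a_2,\ldots$ of $L$ such that $$f=\lim_{k\to+\infty}\sum_{i=1}^{k}\tfrac{1}{i}\cdot\chi_{a_i},$$ where the limit is taken in $\overline{\mathsf{M}}(L)$.
   Context: A $\sigma$-frame is a bounded lattice with all countable joins in which $(\bigvee_{a\in A}a)\wedge b=\bigvee_{a\in A}(a\wedge b)$ for every countable $A$ and every $b$. A $\sigma$-frame homomorphism preserves finite meets (including the top) and countable joins (including the bottom). $\mathfrak{L}(\overline{\mathbb{R}})$ (extended reals) is the frame, equivalently $\sigma$-frame, generated by symbols $(p,\text{---})$, $(\text{---},q)$ with $p,q\in\mathbb{Q}$, subject to: (1) $(p,\text{---})\wedge(\text{---},q)=0$ if $p\ge q$; (2) $(p,\text{---})\vee(\text{---},q)=1$ if $p<q$; (3) $(p,\text{---})=\bigvee_{r>p}(r,\text{---})$; (4) $(\text{---},q)=\bigvee_{s<q}(\text{---},s)$. $\mathfrak{L}(\mathbb{R})$ is defined likewise with the further relations (5) $\bigvee_{p\in\mathbb{Q}}(p,\text{---})=1$ and (6) $\bigvee_{q\in\mathbb{Q}}(\text{---},q)=1$. A measurable extended real function on $L$ is a $\sigma$-frame homomorphism $\mathfrak{L}(\overline{\mathbb{R}})\to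 L$; $\overline{\mathsf{M}}(L)$ is the set of these, ordered by $f\le g$ iff $f(p,\text{---})\le g(p,\text{---})$ for all $p\in\mathbb{Q}$ (equivalently $g(\text{---},q)\le f(\text{---},q)$ for all $q$). $\mathsf{M}(L)$ is the set of $\sigma$-frame homomorphisms $\mathfrak{L}(\mathbb{R})\to L$, regarded as the subset of those $f\in\overline{\mathsf{M}}(L)$ with $\bigvee_p f(p,\text{---})=1=\bigvee_q f(\text{---},q)$. The constant function $\mathbf{0}$: $\mathbf{0}(p,\text{---})=1$ if $p<0$ and $0$ otherwise; $\mathbf{0}(\text{---},q)=1$ if $q>0$ and $0$ otherwise. $f$ is nonnegative if $f\ge\mathbf{0}$. For complemented $a\in L$ with complement $a^c$, $\chi_a\in\mathsf{M}(L)$ is given by $\chi_a(p,\text{---})=1$ if $p<0$, $a$ if $0\le p<1$, $0$ if $p\ge1$; $\chi_a(\text{---},q)=0$ if $q\le0$, $a^c$ if $0<q\le1$, $1$ if $q>1$. For $f,g\in\mathsf{M}(L)$ and rational $\lambda>0$: $(\lambda\cdot f)(p,\text{---})=f(p/\lambda,\text{---})$, $(\lambda\cdot f)(\text{---},q)=f(\text{---},q/\lambda)$; $(f+g)(p,\text{---})=\bigvee_{t\in\mathbb{Q}}(f(t,\text{---})\wedge g(p-t,\text{---}))$, $(f+g)(\text{---},q)=\bigvee_{t\in\mathbb{Q}}(f(\text{---},t)\wedge g(\text{---},q-t))$. Limits: for a sequence $(f_k)_{k\in\mathbb{N}}$ in $\overline{\mathsf{M}}(L)$, with $\sup$, $\inf$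 denoting joins and meets in the poset $\overline{\mathsf{M}}(L)$ (which may fail to exist), $\liminf f_k=\sup_{n\ge1}\inf_{k\ge n}f_k$ and $\limsup f_k=\inf_{n\ge1}\sup_{k\ge n}f_k$. If both exist and are equal, the limit exists and $\lim_k f_k$ is their common value. *)

theory Defs
  imports Complex_Main "HOL-Library.Countable_Set"
begin

section \<open>Sigma-frames and their homomorphisms\<close>

text \<open>The values of \<^const>\<open>Sup\<close> on uncountable sets are unconstrained and carry no meaning.\<close>

class sigma_frame = bounded_lattice + Sup +
  assumes Sup_ub: "countable A \<Longrightarrow> a \<in> A \<Longrightarrow> a \<le> Sup A"
    and Sup_lst: "countable A \<Longrightarrow> (\<And>a. a \<in> A \<Longrightarrow> a \<le> b) \<Longrightarrow> Sup A \<le> b"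
    and Sup_inf_distrib: "countable A \<Longrightarrow> inf (Sup A) b = Sup ((\<lambda>a. inf a b) ` A)"

definition complemented :: "'a::bounded_lattice \<Rightarrow> bool" where
  "complemented a \<longleftrightarrow> (\<exists>b. inf a b = bot \<and> sup a b = top)"

definition compl_of :: "'a::bounded_lattice \<Rightarrow> 'a" where
  "compl_of a = (THE b. inf a b = bot \<and> sup a b = top)"

definition sigma_frame_hom :: "('a::sigma_frame \<Rightarrow> 'b::sigma_frame) \<Rightarrow> bool" where
  "sigma_frame_hom h \<longleftrightarrow>
     h top = top \<and> (\<forall>x y. h (inf x y) = inf (h x) (h y)) \<and>
     h bot = bot \<and> (\<forall>A. countable A \<longrightarrow> h (Sup A) = Sup (h ` A))"

lemma SUP_ub:
  fixes u :: "'i::countable \<Rightarrow> 'a::sigma_frame"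
  shows "i \<in> S \<Longrightarrow> u i \<le> Sup (u ` S)"
  by (rule Sup_ub) auto

lemma SUP_ub2:
  fixes u :: "'i::countable \<Rightarrow> 'a::sigma_frame"
  shows "i \<in> S \<Longrightarrow> x \<le> u i \<Longrightarrow> x \<le> Sup (u ` S)"
  using SUP_ub order_trans by blast

lemma SUP_lst:
  fixes u :: "'i::countable \<Rightarrow> 'a::sigma_frame"
  shows "(\<And>i. i \<in> S \<Longrightarrow> u i \<le> b) \<Longrightarrow> Sup (u ` S) \<le> b"
  by (rule Sup_lst) auto

lemma inf_SUP_le:
  fixes u :: "'i::countable \<Rightarrow> 'a::sigma_frame"
  assumes "\<And>i. i \<in> S \<Longrightarrow> inf (u i) b \<le> c"
  shows "inf (Sup (u ` S)) b \<le> c"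
proof -
  have "inf (Sup (u ` S)) b = Sup ((\<lambda>a. inf a b) ` u ` S)"
    by (rule Sup_inf_distrib) simp
  also have "\<dots> \<le> c" using assms by (intro Sup_lst) auto
  finally show ?thesis .
qed

lemma inf_SUP_le':
  fixes u :: "'i::countable \<Rightarrow> 'a::sigma_frame"
  assumes "\<And>i. i \<in> S \<Longrightarrow> inf b (u i) \<le> c"
  shows "inf b (Sup (u ` S)) \<le> c"
  using inf_SUP_le[of S u b c] assms by (simp add: inf.commute)

lemma sup_eq_Sup: "sup a b = Sup {a, b::'a::sigma_frame}"
  by (rule order.antisym) (auto intro: Sup_ub Sup_lst)

lemma Sup_empty_eq: "Sup {} = (bot :: 'a::sigma_frame)"
  by (rule order.antisym) (auto intro: Sup_lst)

lemma inf_sup_le: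
  fixes a b c d :: "'a::sigma_frame"
  assumes "inf a c \<le> d" "inf b c \<le> d"
  shows "inf (sup a b) c \<le> d"
proof -
  have "inf (sup a b) c = Sup ((\<lambda>x. inf x c) ` {a, b})"
    unfolding sup_eq_Sup by (rule Sup_inf_distrib) simp
  also have "\<dots> \<le> d" using assms by (intro Sup_lst) auto
  finally show ?thesis .
qed

lemma sup_top_le:
  fixes a b c d :: "'a::sigma_frame"
  assumes "sup a b = top" "inf a c \<le> d" "inf b c \<le> d"
  shows "c \<le> d"
  using inf_sup_le[OF assms(2,3)] assms(1) by simp

lemma hom_sup: "sigma_frame_hom h \<Longrightarrow> h (sup a b) = sup (h a) (h b)"
  unfolding sup_eq_Sup sigma_frame_hom_def by simp

lemma compl_of_unique:
  fixes a b :: "'a::sigma_frame"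
  assumes "inf a b = bot" "sup a b = top"
  shows "compl_of a = b"
  unfolding compl_of_def
proof (rule the_equality)
  show "inf a b = bot \<and> sup a b = top" using assms by simp
next
  fix c assume c: "inf a c = bot \<and> sup a c = top"
  have "c \<le> b" using assms c by (intro sup_top_le[of a b c b]) auto
  moreover have "b \<le> c" using assms c by (intro sup_top_le[of a c b c]) auto
  ultimately show "c = b" by simp
qed

lemma compl_of:
  fixes a :: "'a::sigma_frame"
  assumes "complemented a"
  shows "inf a (compl_of a) = bot" "sup a (compl_of a) = top"
  using assms compl_of_unique unfolding complemented_def by blast+


section \<open>Sigma-frames given by generators and relations\<close>

datatype 'g sterm =
    Gen 'g
  | Bot
  | Top
  | Meet "'g sterm" "'g sterm"
  | Join "'g sterm" "'g sterm"
  | CJoin "nat \<Rightarrow> 'g sterm"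

text \<open>The least preorder on terms that satisfies the axioms of a sigma-frame and
  identifies \<open>s\<close> with \<open>t\<close> whenever \<open>(s, t) \<in> R\<close>.\<close>

inductive sle :: "('g sterm \<times> 'g sterm) set \<Rightarrow> 'g sterm \<Rightarrow> 'g sterm \<Rightarrow> bool"
  for R :: "('g sterm \<times> 'g sterm) set" where
  rel1: "(s, t) \<in> R \<Longrightarrow> sle R s t"
| rel2: "(s, t) \<in> R \<Longrightarrow> sle R t s"
| refl: "sle R s s"
| trans: "sle R s t \<Longrightarrow> sle R t u \<Longrightarrow> sle R s u"
| bot: "sle R Bot s"
| top: "sle R s Top"
| meet1: "sle R (Meet s t) s"
| meet2: "sle R (Meet s t) t"
| meet: "sle R u s \<Longrightarrow> sle R u t \<Longrightarrow> sle R u (Meet s t)"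
| join1: "sle R s (Join s t)"
| join2: "sle R t (Join s t)"
| join: "sle R s u \<Longrightarrow> sle R t u \<Longrightarrow> sle R (Join s t) u"
| cjoin1: "sle R (F n) (CJoin F)"
| cjoin: "(\<And>n. sle R (F n) u) \<Longrightarrow> sle R (CJoin F) u"
| distrib: "sle R (Meet (CJoin F) t) (CJoin (\<lambda>n. Meet (F n) t))"

definition seq :: "('g sterm \<times> 'g sterm) set \<Rightarrow> 'g sterm \<Rightarrow> 'g sterm \<Rightarrow> bool" where
  "seq R s t \<longleftrightarrow> sle R s t \<and> sle R t s"

lemma equivp_seq: "equivp (seq R)"
  by (rule equivpI) (unfold reflp_def symp_def transp_def seq_def, (blast intro: sle.refl sle.trans)+)

lemma sle_meet_mono: "sle R s s' \<Longrightarrow> sle R t t' \<Longrightarrow> sle R (Meet s t) (Meet s' t')"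
  by (meson sle.meet sle.meet1 sle.meet2 sle.trans)

lemma sle_join_mono: "sle R s s' \<Longrightarrow> sle R t t' \<Longrightarrow> sle R (Join s t) (Join s' t')"
  by (meson sle.join sle.join1 sle.join2 sle.trans)

lemma sle_cjoin_mono: "(\<And>n. sle R (F n) (G n)) \<Longrightarrow> sle R (CJoin F) (CJoin G)"
  by (meson sle.cjoin sle.cjoin1 sle.trans)

primrec seval :: "('g \<Rightarrow> 'a::sigma_frame) \<Rightarrow> 'g sterm \<Rightarrow> 'a" where
  "seval v (Gen g) = v g"
| "seval v Bot = bot"
| "seval v Top = top"
| "seval v (Meet s t) = inf (seval v s) (seval v t)"
| "seval v (Join s t) = sup (seval v s) (seval v t)"
| "seval v (CJoin F) = Sup (range (\<lambda>n. seval v (F n)))"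

lemma seval_mono:
  assumes "sle R s t" "\<And>s t. (s, t) \<in> R \<Longrightarrow> seval v s = seval v t"
  shows "seval v s \<le> seval v t"
  using assms(1)
proof induction
  case (cjoin1 F n)
  show ?case using SUP_ub[of n UNIV "\<lambda>n. seval v (F n)"] by simp
next
  case (cjoin F u)
  then show ?case by (auto intro: SUP_lst)
next
  case (distrib F t)
  have "inf (Sup (range (\<lambda>n. seval v (F n)))) (seval v t)
      \<le> Sup (range (\<lambda>n. inf (seval v (F n)) (seval v t)))"
    by (rule inf_SUP_le) (rule SUP_ub, simp)
  then show ?case by simp
next
  case (trans s t u)
  then show ?case by (meson order.trans)
qed (auto simp: assms(2))

text \<open>The join, as a term, of the terms \<open>F x\<close> for \<open>x\<close> in a nonempty countable set.\<close>

definition SJoin :: "'b set \<Rightarrow> ('b \<Rightarrow> 'g sterm) \<Rightarrow> 'g sterm" where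
  "SJoin S F = CJoin (\<lambda>n. F (from_nat_into S n))"

lemma range_enum: "countable S \<Longrightarrow> S \<noteq> {} \<Longrightarrow> range (\<lambda>n. G (from_nat_into S n)) = G ` S"
  using range_from_nat_into[of S] image_image[of G "from_nat_into S" UNIV] by simp

lemma seval_SJoin:
  "countable S \<Longrightarrow> S \<noteq> {} \<Longrightarrow> seval v (SJoin S F) = Sup ((\<lambda>x. seval v (F x)) ` S)"
  using range_enum[of S "\<lambda>x. seval v (F x)"] by (simp add: SJoin_def)

lemma sle_SJoin_ub:
  assumes "countable S" "x \<in> S"
  shows "sle R (F x) (SJoin S F)"
proof -
  obtain n where "from_nat_into S n = x"
    using assms by (meson from_nat_into_surj)
  then show ?thesis
    unfolding SJoin_def using sle.cjoin1[of R "\<lambda>n. F (from_nat_into S n)" n] by metis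
qed

lemma sle_SJoin_lst:
  assumes "S \<noteq> {}" "\<And>x. x \<in> S \<Longrightarrow> sle R (F x) u"
  shows "sle R (SJoin S F) u"
  unfolding SJoin_def
proof (rule sle.cjoin)
  show "sle R (F (from_nat_into S n)) u" for n
    by (rule assms(2)) (rule from_nat_into[OF assms(1)])
qed


lemma seq_SJoin_distrib:
  assumes A: "countable A" "A \<noteq> {}"
    and g: "\<And>a. a \<in> A \<Longrightarrow> seq R (F (g a)) (Meet (F a) t)"
  shows "seq R (Meet (SJoin A F) t) (SJoin (g ` A) F)"
proof -
  have "sle R (Meet (SJoin A F) t) (SJoin A (\<lambda>a. Meet (F a) t))"
    unfolding SJoin_def by (rule sle.distrib)
  moreover have "sle R (SJoin A (\<lambda>a. Meet (F a) t)) (SJoin (g ` A) F)"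
    using A(2)
  proof (rule sle_SJoin_lst)
    fix a assume a: "a \<in> A"
    then have "sle R (F (g a)) (SJoin (g ` A) F)"
      using A by (intro sle_SJoin_ub) auto
    with g[OF a] show "sle R (Meet (F a) t) (SJoin (g ` A) F)"
      unfolding seq_def by (meson sle.trans)
  qed
  moreover have "sle R (SJoin (g ` A) F) (Meet (SJoin A F) t)"
  proof (rule sle_SJoin_lst)
    fix c assume "c \<in> g ` A"
    then obtain a where a: "a \<in> A" "c = g a" by auto
    have "sle R (Meet (F a) t) (Meet (SJoin A F) t)"
      using A a by (intro sle_meet_mono sle_SJoin_ub sle.refl)
    with g[OF a(1)] show "sle R (F c) (Meet (SJoin A F) t)"
      unfolding seq_def a(2) by (meson sle.trans)
  qed (use A in simp)
  ultimately show ?thesis unfolding seq_def by (meson sle.trans)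
qed


section \<open>The frames of extended reals and of reals\<close>

text \<open>\<open>Above p\<close> is the generator \<open>(p,\<emdash>)\<close> and \<open>Below q\<close> the generator \<open>(\<emdash>,q)\<close>.\<close>

datatype ray = Above rat | Below rat

inductive_set ext_rels :: "(ray sterm \<times> ray sterm) set" where
  r1: "q \<le> p \<Longrightarrow> (Meet (Gen (Above p)) (Gen (Below q)), Bot) \<in> ext_rels"
| r2: "p < q \<Longrightarrow> (Join (Gen (Above p)) (Gen (Below q)), Top) \<in> ext_rels"
| r3: "(Gen (Above p), SJoin {r. p < r} (\<lambda>r. Gen (Above r))) \<in> ext_rels"
| r4: "(Gen (Below q), SJoin {s. s < q} (\<lambda>s. Gen (Below s))) \<in> ext_rels"

definition real_rels :: "(ray sterm \<times> ray sterm) set" where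
  "real_rels = ext_rels \<union>
     {(SJoin UNIV (\<lambda>p. Gen (Above p)), Top), (SJoin UNIV (\<lambda>q. Gen (Below q)), Top)}"

quotient_type lext = "ray sterm" / "seq ext_rels"
  by (rule equivp_seq)

quotient_type lreal = "ray sterm" / "seq real_rels"
  by (rule equivp_seq)

instantiation lext :: sigma_frame
begin

lift_definition less_eq_lext :: "lext \<Rightarrow> lext \<Rightarrow> bool" is "sle ext_rels"
  unfolding seq_def by (meson sle.trans)
definition less_lext :: "lext \<Rightarrow> lext \<Rightarrow> bool" where
  "less_lext x y \<longleftrightarrow> x \<le> y \<and> \<not> y \<le> x"
lift_definition bot_lext :: lext is Bot .
lift_definition top_lext :: lext is Top .
lift_definition inf_lext :: "lext \<Rightarrow> lext \<Rightarrow> lext" is Meet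
  by (auto simp: seq_def intro: sle_meet_mono)
lift_definition sup_lext :: "lext \<Rightarrow> lext \<Rightarrow> lext" is Join
  by (auto simp: seq_def intro: sle_join_mono)
definition Sup_lext :: "lext set \<Rightarrow> lext" where
  "Sup_lext A = (if A = {} then bot else abs_lext (SJoin A rep_lext))"

lemma abs_rep_lext: "abs_lext (rep_lext x) = x"
  by (rule Quotient3_abs_rep[OF Quotient3_lext])

instance
proof
  fix x y z :: lext
  show "x < y \<longleftrightarrow> x \<le> y \<and> \<not> y \<le> x" by (rule less_lext_def)
  show refl: "x \<le> x" for x :: lext by transfer (rule sle.refl)
  show "x \<le> y \<Longrightarrow> y \<le> z \<Longrightarrow> x \<le> z" by transfer (rule sle.trans)
  show "x \<le> y \<Longrightarrow> y \<le> x \<Longrightarrow> x = y" by transfer (simp add: seq_def)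
  show "inf x y \<le> x" by transfer (rule sle.meet1)
  show "inf x y \<le> y" by transfer (rule sle.meet2)
  show "x \<le> y \<Longrightarrow> x \<le> z \<Longrightarrow> x \<le> inf y z" by transfer (rule sle.meet)
  show "x \<le> sup x y" by transfer (rule sle.join1)
  show "y \<le> sup x y" by transfer (rule sle.join2)
  show "y \<le> x \<Longrightarrow> z \<le> x \<Longrightarrow> sup y z \<le> x" by transfer (rule sle.join)
  show "bot \<le> x" by transfer (rule sle.bot)
  show "x \<le> top" by transfer (rule sle.top)
next
  fix A :: "lext set" and a assume "countable A" "a \<in> A"
  then have "abs_lext (rep_lext a) \<le> abs_lext (SJoin A rep_lext)"
    by (auto simp: less_eq_lext.abs_eq intro: sle_SJoin_ub)
  then show "a \<le> Sup A" using \<open>a \<in> A\<close> by (auto simp: Sup_lext_def abs_rep_lext)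
next
  fix A :: "lext set" and b assume "countable A" and le: "\<And>a. a \<in> A \<Longrightarrow> a \<le> b"
  show "Sup A \<le> b"
  proof (cases "A = {}")
    case True
    have "bot \<le> b" by transfer (rule sle.bot)
    with True show ?thesis by (simp add: Sup_lext_def)
  next
    case False
    have "sle ext_rels (SJoin A rep_lext) (rep_lext b)"
      using False
      by (rule sle_SJoin_lst) (use le in \<open>simp add: less_eq_lext.abs_eq[symmetric] abs_rep_lext\<close>)
    then have "abs_lext (SJoin A rep_lext) \<le> abs_lext (rep_lext b)"
      by (simp add: less_eq_lext.abs_eq)
    with False show ?thesis by (simp add: Sup_lext_def abs_rep_lext)
  qed
next
  fix A :: "lext set" and b assume A: "countable A"
  show "inf (Sup A) b = Sup ((\<lambda>a. inf a b) ` A)"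
  proof (cases "A = {}")
    case True
    have "inf bot b = bot"
      by transfer (simp add: seq_def sle.meet1 sle.bot)
    then show ?thesis by (simp add: True Sup_lext_def)
  next
    case False
    have "abs_lext (rep_lext (inf a b)) = abs_lext (Meet (rep_lext a) (rep_lext b))" for a
      by (simp add: abs_rep_lext inf_lext.abs_eq[symmetric])
    then have "seq ext_rels (Meet (SJoin A rep_lext) (rep_lext b)) (SJoin ((\<lambda>a. inf a b) ` A) rep_lext)"
      using A False by (intro seq_SJoin_distrib) (simp_all add: lext.abs_eq_iff)
    then have "abs_lext (Meet (SJoin A rep_lext) (rep_lext b)) = abs_lext (SJoin ((\<lambda>a. inf a b) ` A) rep_lext)"
      by (simp add: lext.abs_eq_iff)
    then show ?thesis
      using False by (simp add: Sup_lext_def inf_lext.abs_eq[symmetric] abs_rep_lext)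
  qed
qed

end

lift_definition gt_lext :: "rat \<Rightarrow> lext" is "\<lambda>p. Gen (Above p)" .
lift_definition lt_lext :: "rat \<Rightarrow> lext" is "\<lambda>q. Gen (Below q)" .

lemma abs_CJoin_lext: "abs_lext (CJoin F) = Sup (range (\<lambda>n. abs_lext (F n)))"
proof (rule order.antisym)
  define u where "u = rep_lext (Sup (range (\<lambda>n. abs_lext (F n))))"
  have u: "abs_lext u = Sup (range (\<lambda>n. abs_lext (F n)))"
    by (simp add: u_def abs_rep_lext)
  have "abs_lext (F n) \<le> abs_lext u" for n
    unfolding u by (rule SUP_ub) simp
  then have "sle ext_rels (CJoin F) u"
    by (intro sle.cjoin) (simp add: less_eq_lext.abs_eq)
  then show "abs_lext (CJoin F) \<le> Sup (range (\<lambda>n. abs_lext (F n)))"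
    unfolding u[symmetric] by (simp add: less_eq_lext.abs_eq)
  show "Sup (range (\<lambda>n. abs_lext (F n))) \<le> abs_lext (CJoin F)"
    by (rule SUP_lst) (simp add: less_eq_lext.abs_eq sle.cjoin1)
qed

lemma abs_SJoin_lext:
  assumes "countable S" "S \<noteq> {}"
  shows "abs_lext (SJoin S F) = Sup ((\<lambda>x. abs_lext (F x)) ` S)"
  using range_enum[of S "\<lambda>x. abs_lext (F x)"] assms by (simp add: SJoin_def abs_CJoin_lext)

lemma hom_seval_lext:
  assumes h: "sigma_frame_hom h"
  shows "h (abs_lext t) = seval (\<lambda>g. h (abs_lext (Gen g))) t"
proof (induction t)
  case (CJoin F)
  have "h (abs_lext (CJoin F)) = Sup (h ` range (\<lambda>n. abs_lext (F n)))"
    using h by (simp add: abs_CJoin_lext sigma_frame_hom_def)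
  also have "\<dots> = Sup (range (\<lambda>n. h (abs_lext (F n))))" by (simp add: image_image)
  also have "\<dots> = Sup (range (\<lambda>n. seval (\<lambda>g. h (abs_lext (Gen g))) (F n)))"
    using CJoin by simp
  finally show ?case by simp
qed (use h in \<open>simp_all add: hom_sup inf_lext.abs_eq[symmetric] sup_lext.abs_eq[symmetric]
       bot_lext_def[symmetric] top_lext_def[symmetric] sigma_frame_hom_def\<close>)

lemma hom_ext_lext:
  assumes "sigma_frame_hom h" "sigma_frame_hom k"
    and "\<And>p. h (gt_lext p) = k (gt_lext p)" "\<And>q. h (lt_lext q) = k (lt_lext q)"
  shows "h = k"
proof
  fix x
  have "(\<lambda>g. h (abs_lext (Gen g))) = (\<lambda>g. k (abs_lext (Gen g)))"
  proof
    fix g show "h (abs_lext (Gen g)) = k (abs_lext (Gen g))"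
      using assms(3,4) by (cases g) (simp_all add: gt_lext_def lt_lext_def)
  qed
  then show "h x = k x"
    using hom_seval_lext[OF assms(1), of "rep_lext x"] hom_seval_lext[OF assms(2), of "rep_lext x"]
    by (simp add: abs_rep_lext)
qed

lemma hom_exists_lext:
  assumes v: "\<And>s t. (s, t) \<in> ext_rels \<Longrightarrow> seval v s = seval v t"
  shows "\<exists>h :: lext \<Rightarrow> 'a::sigma_frame. sigma_frame_hom h \<and>
    (\<forall>p. h (gt_lext p) = v (Above p)) \<and> (\<forall>q. h (lt_lext q) = v (Below q))"
proof -
  define h where "h x = seval v (rep_lext x)" for x
  have mono: "seval v s \<le> seval v t" if "sle ext_rels s t" for s t
    by (rule seval_mono[OF that]) (rule v)
  have h: "h (abs_lext t) = seval v t" for t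
  proof -
    have "seq ext_rels (rep_lext (abs_lext t)) t"
      by (simp add: lext.abs_eq_iff[symmetric] abs_rep_lext)
    then show ?thesis unfolding h_def seq_def by (intro order.antisym mono) auto
  qed
  have "sigma_frame_hom h"
    unfolding sigma_frame_hom_def
  proof (intro conjI allI impI)
    show "h top = top" by (simp add: top_lext_def h)
    show "h bot = bot" by (simp add: bot_lext_def h)
    show "h (inf x y) = inf (h x) (h y)" for x y
      using h[of "Meet (rep_lext x) (rep_lext y)"]
      by (simp add: inf_lext.abs_eq[symmetric] abs_rep_lext) (simp add: h_def)
    show "h (Sup A) = Sup (h ` A)" if "countable A" for A
    proof (cases "A = {}")
      case True
      then show ?thesis by (simp add: Sup_empty_eq bot_lext_def h)
    next
      case False
      then show ?thesis
        using that by (simp add: Sup_lext_def h seval_SJoin) (simp add: h_def)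
    qed
  qed
  moreover have "h (gt_lext p) = v (Above p)" "h (lt_lext p) = v (Below p)" for p
    by (simp_all add: gt_lext_def lt_lext_def h)
  ultimately show ?thesis by blast
qed


instantiation lreal :: sigma_frame
begin

lift_definition less_eq_lreal :: "lreal \<Rightarrow> lreal \<Rightarrow> bool" is "sle real_rels"
  unfolding seq_def by (meson sle.trans)
definition less_lreal :: "lreal \<Rightarrow> lreal \<Rightarrow> bool" where
  "less_lreal x y \<longleftrightarrow> x \<le> y \<and> \<not> y \<le> x"
lift_definition bot_lreal :: lreal is Bot .
lift_definition top_lreal :: lreal is Top .
lift_definition inf_lreal :: "lreal \<Rightarrow> lreal \<Rightarrow> lreal" is Meet
  by (auto simp: seq_def intro: sle_meet_mono)
lift_definition sup_lreal :: "lreal \<Rightarrow> lreal \<Rightarrow> lreal" is Join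
  by (auto simp: seq_def intro: sle_join_mono)
definition Sup_lreal :: "lreal set \<Rightarrow> lreal" where
  "Sup_lreal A = (if A = {} then bot else abs_lreal (SJoin A rep_lreal))"

lemma abs_rep_lreal: "abs_lreal (rep_lreal x) = x"
  by (rule Quotient3_abs_rep[OF Quotient3_lreal])

instance
proof
  fix x y z :: lreal
  show "x < y \<longleftrightarrow> x \<le> y \<and> \<not> y \<le> x" by (rule less_lreal_def)
  show refl: "x \<le> x" for x :: lreal by transfer (rule sle.refl)
  show "x \<le> y \<Longrightarrow> y \<le> z \<Longrightarrow> x \<le> z" by transfer (rule sle.trans)
  show "x \<le> y \<Longrightarrow> y \<le> x \<Longrightarrow> x = y" by transfer (simp add: seq_def)
  show "inf x y \<le> x" by transfer (rule sle.meet1)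
  show "inf x y \<le> y" by transfer (rule sle.meet2)
  show "x \<le> y \<Longrightarrow> x \<le> z \<Longrightarrow> x \<le> inf y z" by transfer (rule sle.meet)
  show "x \<le> sup x y" by transfer (rule sle.join1)
  show "y \<le> sup x y" by transfer (rule sle.join2)
  show "y \<le> x \<Longrightarrow> z \<le> x \<Longrightarrow> sup y z \<le> x" by transfer (rule sle.join)
  show "bot \<le> x" by transfer (rule sle.bot)
  show "x \<le> top" by transfer (rule sle.top)
next
  fix A :: "lreal set" and a assume "countable A" "a \<in> A"
  then have "abs_lreal (rep_lreal a) \<le> abs_lreal (SJoin A rep_lreal)"
    by (auto simp: less_eq_lreal.abs_eq intro: sle_SJoin_ub)
  then show "a \<le> Sup A" using \<open>a \<in> A\<close> by (auto simp: Sup_lreal_def abs_rep_lreal)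
next
  fix A :: "lreal set" and b assume "countable A" and le: "\<And>a. a \<in> A \<Longrightarrow> a \<le> b"
  show "Sup A \<le> b"
  proof (cases "A = {}")
    case True
    have "bot \<le> b" by transfer (rule sle.bot)
    with True show ?thesis by (simp add: Sup_lreal_def)
  next
    case False
    have "sle real_rels (SJoin A rep_lreal) (rep_lreal b)"
      using False
      by (rule sle_SJoin_lst) (use le in \<open>simp add: less_eq_lreal.abs_eq[symmetric] abs_rep_lreal\<close>)
    then have "abs_lreal (SJoin A rep_lreal) \<le> abs_lreal (rep_lreal b)"
      by (simp add: less_eq_lreal.abs_eq)
    with False show ?thesis by (simp add: Sup_lreal_def abs_rep_lreal)
  qed
next
  fix A :: "lreal set" and b assume A: "countable A"
  show "inf (Sup A) b = Sup ((\<lambda>a. inf a b) ` A)"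
  proof (cases "A = {}")
    case True
    have "inf bot b = bot"
      by transfer (simp add: seq_def sle.meet1 sle.bot)
    then show ?thesis by (simp add: True Sup_lreal_def)
  next
    case False
    have "abs_lreal (rep_lreal (inf a b)) = abs_lreal (Meet (rep_lreal a) (rep_lreal b))" for a
      by (simp add: abs_rep_lreal inf_lreal.abs_eq[symmetric])
    then have "seq real_rels (Meet (SJoin A rep_lreal) (rep_lreal b)) (SJoin ((\<lambda>a. inf a b) ` A) rep_lreal)"
      using A False by (intro seq_SJoin_distrib) (simp_all add: lreal.abs_eq_iff)
    then have "abs_lreal (Meet (SJoin A rep_lreal) (rep_lreal b)) = abs_lreal (SJoin ((\<lambda>a. inf a b) ` A) rep_lreal)"
      by (simp add: lreal.abs_eq_iff)
    then show ?thesis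
      using False by (simp add: Sup_lreal_def inf_lreal.abs_eq[symmetric] abs_rep_lreal)
  qed
qed

end

lift_definition gt_lreal :: "rat \<Rightarrow> lreal" is "\<lambda>p. Gen (Above p)" .
lift_definition lt_lreal :: "rat \<Rightarrow> lreal" is "\<lambda>q. Gen (Below q)" .

lemma abs_CJoin_lreal: "abs_lreal (CJoin F) = Sup (range (\<lambda>n. abs_lreal (F n)))"
proof (rule order.antisym)
  define u where "u = rep_lreal (Sup (range (\<lambda>n. abs_lreal (F n))))"
  have u: "abs_lreal u = Sup (range (\<lambda>n. abs_lreal (F n)))"
    by (simp add: u_def abs_rep_lreal)
  have "abs_lreal (F n) \<le> abs_lreal u" for n
    unfolding u by (rule SUP_ub) simp
  then have "sle real_rels (CJoin F) u"
    by (intro sle.cjoin) (simp add: less_eq_lreal.abs_eq)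
  then show "abs_lreal (CJoin F) \<le> Sup (range (\<lambda>n. abs_lreal (F n)))"
    unfolding u[symmetric] by (simp add: less_eq_lreal.abs_eq)
  show "Sup (range (\<lambda>n. abs_lreal (F n))) \<le> abs_lreal (CJoin F)"
    by (rule SUP_lst) (simp add: less_eq_lreal.abs_eq sle.cjoin1)
qed

lemma abs_SJoin_lreal:
  assumes "countable S" "S \<noteq> {}"
  shows "abs_lreal (SJoin S F) = Sup ((\<lambda>x. abs_lreal (F x)) ` S)"
  using range_enum[of S "\<lambda>x. abs_lreal (F x)"] assms by (simp add: SJoin_def abs_CJoin_lreal)

lemma hom_seval_lreal:
  assumes h: "sigma_frame_hom h"
  shows "h (abs_lreal t) = seval (\<lambda>g. h (abs_lreal (Gen g))) t"
proof (induction t)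
  case (CJoin F)
  have "h (abs_lreal (CJoin F)) = Sup (h ` range (\<lambda>n. abs_lreal (F n)))"
    using h by (simp add: abs_CJoin_lreal sigma_frame_hom_def)
  also have "\<dots> = Sup (range (\<lambda>n. h (abs_lreal (F n))))" by (simp add: image_image)
  also have "\<dots> = Sup (range (\<lambda>n. seval (\<lambda>g. h (abs_lreal (Gen g))) (F n)))"
    using CJoin by simp
  finally show ?case by simp
qed (use h in \<open>simp_all add: hom_sup inf_lreal.abs_eq[symmetric] sup_lreal.abs_eq[symmetric]
       bot_lreal_def[symmetric] top_lreal_def[symmetric] sigma_frame_hom_def\<close>)

lemma hom_ext_lreal:
  assumes "sigma_frame_hom h" "sigma_frame_hom k"
    and "\<And>p. h (gt_lreal p) = k (gt_lreal p)" "\<And>q. h (lt_lreal q) = k (lt_lreal q)"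
  shows "h = k"
proof
  fix x
  have "(\<lambda>g. h (abs_lreal (Gen g))) = (\<lambda>g. k (abs_lreal (Gen g)))"
  proof
    fix g show "h (abs_lreal (Gen g)) = k (abs_lreal (Gen g))"
      using assms(3,4) by (cases g) (simp_all add: gt_lreal_def lt_lreal_def)
  qed
  then show "h x = k x"
    using hom_seval_lreal[OF assms(1), of "rep_lreal x"] hom_seval_lreal[OF assms(2), of "rep_lreal x"]
    by (simp add: abs_rep_lreal)
qed

lemma hom_exists_lreal:
  assumes v: "\<And>s t. (s, t) \<in> real_rels \<Longrightarrow> seval v s = seval v t"
  shows "\<exists>h :: lreal \<Rightarrow> 'a::sigma_frame. sigma_frame_hom h \<and>
    (\<forall>p. h (gt_lreal p) = v (Above p)) \<and> (\<forall>q. h (lt_lreal q) = v (Below q))"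
proof -
  define h where "h x = seval v (rep_lreal x)" for x
  have mono: "seval v s \<le> seval v t" if "sle real_rels s t" for s t
    by (rule seval_mono[OF that]) (rule v)
  have h: "h (abs_lreal t) = seval v t" for t
  proof -
    have "seq real_rels (rep_lreal (abs_lreal t)) t"
      by (simp add: lreal.abs_eq_iff[symmetric] abs_rep_lreal)
    then show ?thesis unfolding h_def seq_def by (intro order.antisym mono) auto
  qed
  have "sigma_frame_hom h"
    unfolding sigma_frame_hom_def
  proof (intro conjI allI impI)
    show "h top = top" by (simp add: top_lreal_def h)
    show "h bot = bot" by (simp add: bot_lreal_def h)
    show "h (inf x y) = inf (h x) (h y)" for x y
      using h[of "Meet (rep_lreal x) (rep_lreal y)"]
      by (simp add: inf_lreal.abs_eq[symmetric] abs_rep_lreal) (simp add: h_def)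
    show "h (Sup A) = Sup (h ` A)" if "countable A" for A
    proof (cases "A = {}")
      case True
      then show ?thesis by (simp add: Sup_empty_eq bot_lreal_def h)
    next
      case False
      then show ?thesis
        using that by (simp add: Sup_lreal_def h seval_SJoin) (simp add: h_def)
    qed
  qed
  moreover have "h (gt_lreal p) = v (Above p)" "h (lt_lreal p) = v (Below p)" for p
    by (simp_all add: gt_lreal_def lt_lreal_def h)
  ultimately show ?thesis by blast
qed


section \<open>Valuations of the generators\<close>

text \<open>The relations of \<open>ext_rels\<close>, respectively \<open>real_rels\<close>, read in a sigma-frame
  for the assignment \<open>(p,\<emdash>) \<mapsto> u p\<close> and \<open>(\<emdash>,q) \<mapsto> v q\<close>.\<close>

definition ext_cut :: "(rat \<Rightarrow> 'a::sigma_frame) \<Rightarrow> (rat \<Rightarrow> 'a) \<Rightarrow> bool" where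
  "ext_cut u v \<longleftrightarrow>
     (\<forall>p q. q \<le> p \<longrightarrow> inf (u p) (v q) = bot) \<and>
     (\<forall>p q. p < q \<longrightarrow> sup (u p) (v q) = top) \<and>
     (\<forall>p. u p = Sup (u ` {r. p < r})) \<and>
     (\<forall>q. v q = Sup (v ` {s. s < q}))"

definition real_cut :: "(rat \<Rightarrow> 'a::sigma_frame) \<Rightarrow> (rat \<Rightarrow> 'a) \<Rightarrow> bool" where
  "real_cut u v \<longleftrightarrow> ext_cut u v \<and> Sup (range u) = top \<and> Sup (range v) = top"

lemma ext_cutD:
  assumes "ext_cut u v"
  shows "q \<le> p \<Longrightarrow> inf (u p) (v q) = bot" "p < q \<Longrightarrow> sup (u p) (v q) = top"
    "u p = Sup (u ` {r. p < r})" "v q = Sup (v ` {s. s < q})"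
  using assms unfolding ext_cut_def by blast+

lemma seval_rays:
  "seval v (SJoin {r::rat. p < r} F) = Sup ((\<lambda>x. seval v (F x)) ` {r. p < r})"
  "seval v (SJoin {r::rat. r < p} F) = Sup ((\<lambda>x. seval v (F x)) ` {r. r < p})"
  by (rule seval_SJoin; use gt_ex[of p] lt_ex[of p] in auto)+

lemma ext_rels_cut:
  "(\<forall>(s, t) \<in> ext_rels. seval v s = seval v t) \<longleftrightarrow> ext_cut (\<lambda>p. v (Above p)) (\<lambda>q. v (Below q))"
    (is "?L \<longleftrightarrow> ?R")
proof
  assume L: ?L
  show ?R
    unfolding ext_cut_def
  proof (intro conjI allI impI)
    show "inf (v (Above p)) (v (Below q)) = bot" if "q \<le> p" for p q
      using L ext_rels.r1[OF that] by fastforce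
    show "sup (v (Above p)) (v (Below q)) = top" if "p < q" for p q
      using L ext_rels.r2[OF that] by fastforce
    show "v (Above p) = Sup ((\<lambda>p. v (Above p)) ` {r. p < r})" for p
      using bspec[OF L ext_rels.r3[of p]] by (simp add: seval_rays)
    show "v (Below q) = Sup ((\<lambda>q. v (Below q)) ` {s. s < q})" for q
      using bspec[OF L ext_rels.r4[of q]] by (simp add: seval_rays)
  qed
next
  assume R: ?R
  have "seval v s = seval v t" if "(s, t) \<in> ext_rels" for s t
    using that
  proof cases
    case (r3 p)
    then show ?thesis using ext_cutD(3)[OF R, of p] by (simp add: seval_rays)
  next
    case (r4 p)
    then show ?thesis using ext_cutD(4)[OF R, of p] by (simp add: seval_rays)
  qed (simp_all add: ext_cutD(1,2)[OF R])
  then show ?L by auto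
qed

lemma real_rels_cut:
  "(\<forall>(s, t) \<in> real_rels. seval v s = seval v t) \<longleftrightarrow> real_cut (\<lambda>p. v (Above p)) (\<lambda>q. v (Below q))"
proof -
  have "(\<forall>(s, t) \<in> real_rels. seval v s = seval v t) \<longleftrightarrow>
      (\<forall>(s, t) \<in> ext_rels. seval v s = seval v t) \<and>
      Sup (range (\<lambda>p. v (Above p))) = top \<and> Sup (range (\<lambda>q. v (Below q))) = top"
    unfolding real_rels_def ball_Un by (simp add: seval_SJoin)
  then show ?thesis by (simp add: ext_rels_cut real_cut_def)
qed

lemma hom_ext_cut:
  assumes "sigma_frame_hom (h :: lext \<Rightarrow> 'a::sigma_frame)"
  shows "ext_cut (\<lambda>p. h (gt_lext p)) (\<lambda>q. h (lt_lext q))"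
proof -
  have "h (abs_lext s) = h (abs_lext t)" if "(s, t) \<in> ext_rels" for s t
  proof -
    have "seq ext_rels s t" using that by (simp add: seq_def sle.rel1 sle.rel2)
    then have "abs_lext s = abs_lext t" by (simp add: lext.abs_eq_iff)
    then show ?thesis by simp
  qed
  then show ?thesis
    using ext_rels_cut[of "\<lambda>g. h (abs_lext (Gen g))"]
    by (auto simp: hom_seval_lext[OF assms, symmetric] gt_lext_def lt_lext_def)
qed

lemma hom_real_cut:
  assumes "sigma_frame_hom (h :: lreal \<Rightarrow> 'a::sigma_frame)"
  shows "real_cut (\<lambda>p. h (gt_lreal p)) (\<lambda>q. h (lt_lreal q))"
proof -
  have "h (abs_lreal s) = h (abs_lreal t)" if "(s, t) \<in> real_rels" for s t
  proof -
    have "seq real_rels s t" using that by (simp add: seq_def sle.rel1 sle.rel2)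
    then have "abs_lreal s = abs_lreal t" by (simp add: lreal.abs_eq_iff)
    then show ?thesis by simp
  qed
  then show ?thesis
    using real_rels_cut[of "\<lambda>g. h (abs_lreal (Gen g))"]
    by (auto simp: hom_seval_lreal[OF assms, symmetric] gt_lreal_def lt_lreal_def)
qed

lemma ext_cut_hom:
  assumes "ext_cut u v"
  shows "\<exists>h :: lext \<Rightarrow> 'a::sigma_frame.
    sigma_frame_hom h \<and> (\<forall>p. h (gt_lext p) = u p) \<and> (\<forall>q. h (lt_lext q) = v q)"
  using hom_exists_lext[of "case_ray u v"] ext_rels_cut[of "case_ray u v"] assms by auto

lemma real_cut_hom:
  assumes "real_cut u v"
  shows "\<exists>h :: lreal \<Rightarrow> 'a::sigma_frame.
    sigma_frame_hom h \<and> (\<forall>p. h (gt_lreal p) = u p) \<and> (\<forall>q. h (lt_lreal q) = v q)"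
  using hom_exists_lreal[of "case_ray u v"] real_rels_cut[of "case_ray u v"] assms by auto

lemma ext_cut_mono:
  assumes "ext_cut u v"
  shows "p \<le> q \<Longrightarrow> u q \<le> u p" "p \<le> q \<Longrightarrow> v p \<le> v q"
proof -
  show "u q \<le> u p" if "p \<le> q"
  proof (cases "p = q")
    case False
    then have "q \<in> {r. p < r}" using that by simp
    then have "u q \<le> Sup (u ` {r. p < r})" by (rule SUP_ub)
    then show ?thesis using ext_cutD(3)[OF assms, of p] by simp
  qed simp
  show "v p \<le> v q" if "p \<le> q"
  proof (cases "p = q")
    case False
    then have "p \<in> {r. r < q}" using that by simp
    then have "v p \<le> Sup (v ` {r. r < q})" by (rule SUP_ub)
    then show ?thesis using ext_cutD(4)[OF assms, of q] by simp
  qed simp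
qed

lemma ext_cutI:
  assumes "\<And>p q. q \<le> p \<Longrightarrow> inf (u p) (v q) = bot" "\<And>p q. p < q \<Longrightarrow> sup (u p) (v q) = top"
    and "\<And>p r. p < r \<Longrightarrow> u r \<le> u p" "\<And>p. u p \<le> Sup (u ` {r. p < r})"
    and "\<And>s q. s < q \<Longrightarrow> v s \<le> v q" "\<And>q. v q \<le> Sup (v ` {s. s < q})"
  shows "ext_cut u v"
  unfolding ext_cut_def
proof (intro conjI allI impI)
  show "u p = Sup (u ` {r. p < r})" for p
    using assms(3,4) by (intro order.antisym SUP_lst) auto
  show "v q = Sup (v ` {s. s < q})" for q
    using assms(5,6) by (intro order.antisym SUP_lst) auto
qed (use assms(1,2) in auto)

lemma real_cut_chi:
  fixes a b :: "'a::sigma_frame"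
  assumes "inf a b = bot" "sup a b = top"
  shows "real_cut (\<lambda>p. if p < 0 then top else if p < 1 then a else bot)
                  (\<lambda>q. if q \<le> 0 then bot else if q \<le> 1 then b else top)" (is "real_cut ?u ?v")
  unfolding real_cut_def
proof (intro conjI)
  show "ext_cut ?u ?v"
  proof (rule ext_cutI)
    fix p :: rat
    obtain r where r: "p < r" "p < 0 \<Longrightarrow> r < 0" "p < 1 \<Longrightarrow> r < 1"
    proof (cases "p < 0")
      case True
      then show ?thesis using dense[of p 0] that by force
    next
      case False
      then show ?thesis using dense[of p 1] gt_ex[of p] that by (cases "p < 1") force+
    qed
    have "?u r \<le> Sup (?u ` {r. p < r})" using r(1) by (intro SUP_ub) simp
    moreover have "?u p \<le> ?u r" using r by auto
    ultimately show "?u p \<le> Sup (?u ` {r. p < r})" by (rule order.trans[rotated])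
  next
    fix q :: rat
    obtain s where s: "s < q" "0 < q \<Longrightarrow> 0 < s" "1 < q \<Longrightarrow> 1 < s"
    proof (cases "1 < q")
      case True
      then show ?thesis using dense[of 1 q] that by force
    next
      case False
      then show ?thesis using dense[of 0 q] lt_ex[of q] that by (cases "0 < q") force+
    qed
    have "?v s \<le> Sup (?v ` {s. s < q})" using s(1) by (intro SUP_ub) simp
    moreover have "?v q \<le> ?v s" using s by auto
    ultimately show "?v q \<le> Sup (?v ` {s. s < q})" by (rule order.trans[rotated])
  qed (use assms in auto)
  show "Sup (range ?u) = top"
    using SUP_ub[of "-1" UNIV ?u] by (simp add: top.extremum_unique)
  show "Sup (range ?v) = top"
    using SUP_ub[of 2 UNIV ?v] by (simp add: top.extremum_unique)
qed

lemma real_cut_zero: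
  "real_cut (\<lambda>p. if p < 0 then top else bot) (\<lambda>q. if 0 < q then top else (bot :: 'a::sigma_frame))"
proof -
  have "(\<lambda>p::rat. if p < 0 then top else if p < 1 then bot else bot) =
      (\<lambda>p. if p < 0 then top else (bot :: 'a))"
    "(\<lambda>q::rat. if q \<le> 0 then bot else if q \<le> 1 then top else top) =
      (\<lambda>q. if 0 < q then top else (bot :: 'a))" by auto
  with real_cut_chi[of "bot :: 'a" top] show ?thesis by simp
qed

lemma real_cut_scale:
  fixes c :: rat
  assumes "0 < c" "real_cut u v"
  shows "real_cut (\<lambda>p. u (p / c)) (\<lambda>q. v (q / c))"
proof -
  have img: "(\<lambda>p. w (p / c)) ` {p. P (p / c)} = w ` {p. P p}" for w :: "rat \<Rightarrow> 'a" and P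
  proof -
    have "w x \<in> (\<lambda>p. w (p / c)) ` {p. P (p / c)}" if "P x" for x
      using that \<open>0 < c\<close> by (intro image_eqI[of _ _ "x * c"]) auto
    then show ?thesis by auto
  qed
  have lt: "p < r \<longleftrightarrow> p / c < r / c" for p r
    using \<open>0 < c\<close> by (simp add: divide_less_cancel)
  have e: "ext_cut u v" using assms by (simp add: real_cut_def)
  have "ext_cut (\<lambda>p. u (p / c)) (\<lambda>q. v (q / c))"
    unfolding ext_cut_def
  proof (intro conjI allI impI)
    show "inf (u (p / c)) (v (q / c)) = bot" if "q \<le> p" for p q
      using that \<open>0 < c\<close> by (intro ext_cutD(1)[OF e]) (simp add: divide_right_mono)
    show "sup (u (p / c)) (v (q / c)) = top" if "p < q" for p q
      using that \<open>0 < c\<close> by (intro ext_cutD(2)[OF e]) (simp add: divide_strict_right_mono)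
    show "u (p / c) = Sup ((\<lambda>p. u (p / c)) ` {r. p < r})" for p
      unfolding lt[of p] img[of u "\<lambda>r. p / c < r"] by (rule ext_cutD(3)[OF e])
    show "v (q / c) = Sup ((\<lambda>q. v (q / c)) ` {s. s < q})" for q
      unfolding lt[of _ q] img[of v "\<lambda>s. s < q / c"] by (rule ext_cutD(4)[OF e])
  qed
  then show ?thesis
    using assms img[of u "\<lambda>_. True"] img[of v "\<lambda>_. True"] by (simp add: real_cut_def)
qed

text \<open>The formula for the values of a sum.\<close>

definition conv :: "(rat \<Rightarrow> 'a::sigma_frame) \<Rightarrow> (rat \<Rightarrow> 'a) \<Rightarrow> rat \<Rightarrow> 'a" where
  "conv u w p = Sup (range (\<lambda>t. inf (u t) (w (p - t))))"

lemma conv_ub: "inf (u s) (w t) \<le> conv u w (s + t)"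
  unfolding conv_def using SUP_ub[of s UNIV "\<lambda>r. inf (u r) (w (s + t - r))"] by simp

lemma conv_ub': "s + t = p \<Longrightarrow> inf (u s) (w t) \<le> conv u w p"
  using conv_ub[of u s w t] by simp

lemma conv_lst:
  "(\<And>s t. s + t = p \<Longrightarrow> inf (u s) (w t) \<le> b) \<Longrightarrow> conv u w p \<le> b"
  unfolding conv_def by (rule SUP_lst) simp

lemma inf_conv_le:
  assumes "\<And>s t. s + t = p \<Longrightarrow> inf (inf (u s) (w t)) c \<le> b"
  shows "inf (conv u w p) c \<le> b"
  unfolding conv_def by (rule inf_SUP_le) (simp add: assms)

lemma conv_commute: "conv u w = conv w u"
proof -
  have "conv u w p \<le> conv w u p" for u w :: "rat \<Rightarrow> 'a" and p
    by (rule conv_lst) (metis add.commute conv_ub' inf.commute)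
  then show ?thesis by (intro ext order.antisym)
qed

lemma conv_assoc: "conv (conv u v) w = conv u (conv v w)"
proof -
  have le: "conv (conv u v) w p \<le> conv u (conv v w) p" for u v w :: "rat \<Rightarrow> 'a" and p
  proof (rule conv_lst, rule inf_conv_le)
    fix s t s' t' assume "s + t = p" "s' + t' = s"
    then have "inf (u s') (conv v w (t' + t)) \<le> conv u (conv v w) p"
      by (intro conv_ub') auto
    moreover have "inf (inf (u s') (v t')) (w t) \<le> inf (u s') (conv v w (t' + t))"
      using conv_ub[of v t' w t] by (simp add: inf.assoc le_infI2)
    ultimately show "inf (inf (u s') (v t')) (w t) \<le> conv u (conv v w) p"
      by (rule order.trans[rotated])
  qed
  have "conv u (conv v w) p \<le> conv (conv u v) w p" for p
    using le[of w v u p] by (simp add: conv_commute)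
  with le show ?thesis by (intro ext order.antisym)
qed

lemma real_cut_gap:
  assumes "real_cut u v" "0 < e"
  shows "Sup (range (\<lambda>t. inf (u t) (v (t + e)))) = top" (is "?X = _")
proof -
  have c: "ext_cut u v" using assms by (simp add: real_cut_def)
  have chain: "inf (u p) (v (p + of_nat n * (e / 2))) \<le> ?X" for p n
  proof (induction n)
    case 0
    then show ?case using ext_cutD(1)[OF c, of p p] by simp
  next
    case (Suc n)
    define s where "s = p + of_nat n * (e / 2) - e / 2"
    have eq: "p + of_nat (Suc n) * (e / 2) = s + e" "p + of_nat n * (e / 2) = s + e / 2"
      by (simp_all add: s_def algebra_simps)
    have "inf (u s) (v (s + e)) \<le> ?X" by (rule SUP_ub[of s UNIV "\<lambda>t. inf (u t) (v (t + e))"]) simp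
    then have 1: "inf (u s) (inf (u p) (v (s + e))) \<le> ?X"
      by (meson inf.cobounded1 inf.cobounded2 le_infI order.trans)
    have 2: "inf (v (s + e / 2)) (inf (u p) (v (s + e))) \<le> ?X"
      using Suc unfolding eq by (meson inf.cobounded1 inf.cobounded2 le_infI order.trans)
    have "sup (u s) (v (s + e / 2)) = top" using \<open>0 < e\<close> by (intro ext_cutD(2)[OF c]) simp
    from sup_top_le[OF this 1 2] show ?case unfolding eq .
  qed
  have all: "inf (u p) (v q) \<le> ?X" for p q
  proof -
    obtain n where n: "(q - p) / (e / 2) < of_nat n" using reals_Archimedean2 by blast
    then have "q - p < of_nat n * (e / 2)" using \<open>0 < e\<close> by (simp add: field_simps)
    then have "v q \<le> v (p + of_nat n * (e / 2))" by (intro ext_cut_mono(2)[OF c]) simp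
    then show ?thesis using chain[of p n] by (meson inf_mono order.refl order.trans)
  qed
  have "inf (Sup (range u)) (Sup (range v)) \<le> ?X"
    by (intro inf_SUP_le inf_SUP_le' all)
  then show ?thesis using assms by (simp add: real_cut_def top.extremum_unique)
qed

lemma real_cut_conv:
  assumes c: "real_cut u v" and c': "real_cut u' v'"
  shows "real_cut (conv u u') (conv v v')"
  unfolding real_cut_def
proof (intro conjI)
  have e: "ext_cut u v" and e': "ext_cut u' v'" using assms by (auto simp: real_cut_def)
  show "ext_cut (conv u u') (conv v v')"
  proof (rule ext_cutI)
    fix p q :: rat assume "q \<le> p"
    have "inf (conv u u' p) (conv v v' q) \<le> bot"
    proof (rule inf_conv_le, subst inf.commute, rule inf_conv_le)
      fix s t s' t' assume st: "s + t = p" "s' + t' = q"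
      show "inf (inf (v s') (v' t')) (inf (u s) (u' t)) \<le> bot"
      proof (cases "s' \<le> s")
        case True
        then have "inf (u s) (v s') = bot" by (rule ext_cutD[OF e])
        then show ?thesis by (metis inf.assoc inf.commute inf_bot_right order.refl)
      next
        case False
        then have "t' \<le> t" using st \<open>q \<le> p\<close> by simp
        then have "inf (u' t) (v' t') = bot" by (rule ext_cutD[OF e'])
        then show ?thesis by (metis inf.assoc inf.commute inf_bot_right order.refl)
      qed
    qed
    then show "inf (conv u u' p) (conv v v' q) = bot" by (simp add: bot.extremum_unique)
  next
    fix p q :: rat assume "p < q"
    define d where "d = (q - p) / 2"
    have d: "0 < d" using \<open>p < q\<close> by (simp add: d_def)
    let ?S = "sup (conv u u' p) (conv v v' q)"
    have "inf (u t) (v (t + d)) \<le> ?S" for t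
    proof (rule sup_top_le)
      have "p - t < q - (t + d)" using \<open>p < q\<close> by (simp add: d_def field_simps)
      then show "sup (u' (p - t)) (v' (q - (t + d))) = top" by (rule ext_cutD[OF e'])
      have "inf (u t) (u' (p - t)) \<le> ?S" "inf (v (t + d)) (v' (q - (t + d))) \<le> ?S"
        by (simp_all add: le_supI1 le_supI2 conv_ub')
      then show "inf (u' (p - t)) (inf (u t) (v (t + d))) \<le> ?S"
        "inf (v' (q - (t + d))) (inf (u t) (v (t + d))) \<le> ?S"
        by (meson inf.cobounded1 inf.cobounded2 le_infI order.trans)+
    qed
    then have "Sup (range (\<lambda>t. inf (u t) (v (t + d)))) \<le> ?S" by (intro SUP_lst)
    then show "?S = top" using real_cut_gap[OF c d] by (simp add: top.extremum_unique)
  next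
    fix p r :: rat assume "p < r"
    show "conv u u' r \<le> conv u u' p"
    proof (rule conv_lst)
      fix s t assume st: "s + t = r"
      have "inf (u s) (u' t) \<le> inf (u s) (u' (p - s))"
        using st \<open>p < r\<close> by (intro inf_mono ext_cut_mono(1)[OF e']) auto
      also have "\<dots> \<le> conv u u' p" by (rule conv_ub') simp
      finally show "inf (u s) (u' t) \<le> conv u u' p" .
    qed
  next
    fix s q :: rat assume "s < q"
    show "conv v v' s \<le> conv v v' q"
    proof (rule conv_lst)
      fix x t assume st: "x + t = s"
      have "inf (v x) (v' t) \<le> inf (v x) (v' (q - x))"
        using st \<open>s < q\<close> by (intro inf_mono ext_cut_mono(2)[OF e']) auto
      also have "\<dots> \<le> conv v v' q" by (rule conv_ub') simp
      finally show "inf (v x) (v' t) \<le> conv v v' q" .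
    qed
  next
    fix p
    show "conv u u' p \<le> Sup (conv u u' ` {r. p < r})"
    proof (rule conv_lst)
      fix s t assume st: "s + t = p"
      have "inf (u s) (Sup (u' ` {r. t < r})) \<le> Sup (conv u u' ` {r. p < r})"
      proof (rule inf_SUP_le')
        fix r assume "r \<in> {r. t < r}"
        then have "s + r \<in> {r. p < r}" using st by simp
        then show "inf (u s) (u' r) \<le> Sup (conv u u' ` {r. p < r})"
          by (rule SUP_ub2) (rule conv_ub)
      qed
      then show "inf (u s) (u' t) \<le> Sup (conv u u' ` {r. p < r})"
        using ext_cutD(3)[OF e', of t] by simp
    qed
  next
    fix q
    show "conv v v' q \<le> Sup (conv v v' ` {r. r < q})"
    proof (rule conv_lst)
      fix s t assume st: "s + t = q"
      have "inf (v s) (Sup (v' ` {r. r < t})) \<le> Sup (conv v v' ` {r. r < q})"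
      proof (rule inf_SUP_le')
        fix r assume "r \<in> {r. r < t}"
        then have "s + r \<in> {r. r < q}" using st by simp
        then show "inf (v s) (v' r) \<le> Sup (conv v v' ` {r. r < q})"
          by (rule SUP_ub2) (rule conv_ub)
      qed
      then show "inf (v s) (v' t) \<le> Sup (conv v v' ` {r. r < q})"
        using ext_cutD(4)[OF e', of t] by simp
    qed
  qed
next
  have tot: "Sup (range (conv w w')) = top"
    if "Sup (range w) = top" "Sup (range w') = top" for w w' :: "rat \<Rightarrow> 'a"
  proof -
    have "inf (w s) (w' t) \<le> Sup (range (conv w w'))" for s t
      using conv_ub[of w s w' t] by (intro SUP_ub2[of "s + t" UNIV _ "conv w w'"]) simp_all
    then have "inf (Sup (range w)) (Sup (range w')) \<le> Sup (range (conv w w'))"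
      by (intro inf_SUP_le inf_SUP_le')
    then show ?thesis using that by (simp add: top.extremum_unique)
  qed
  show "Sup (range (conv u u')) = top" "Sup (range (conv v v')) = top"
    using assms by (auto intro: tot simp: real_cut_def)
qed

lemma conv_zero:
  assumes "ext_cut u v"
  shows "conv (\<lambda>p. if p < 0 then top else bot) u = u"
    and "conv (\<lambda>q. if 0 < q then top else bot) v = v"
proof -
  show "conv (\<lambda>p. if p < 0 then top else bot) u = u"
  proof (intro ext order.antisym)
    fix p
    show "conv (\<lambda>p. if p < 0 then top else bot) u p \<le> u p"
      by (rule conv_lst) (auto intro: ext_cut_mono(1)[OF assms])
    have "Sup (u ` {r. p < r}) \<le> conv (\<lambda>p. if p < 0 then top else bot) u p"
    proof (rule SUP_lst)
      fix r assume "r \<in> {r. p < r}"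
      then show "u r \<le> conv (\<lambda>p. if p < 0 then top else bot) u p"
        using conv_ub'[of "p - r" r p "\<lambda>p. if p < 0 then top else bot" u] by simp
    qed
    then show "u p \<le> conv (\<lambda>p. if p < 0 then top else bot) u p"
      using ext_cutD(3)[OF assms, of p] by simp
  qed
  show "conv (\<lambda>q. if 0 < q then top else bot) v = v"
  proof (intro ext order.antisym)
    fix p
    show "conv (\<lambda>p. if 0 < p then top else bot) v p \<le> v p"
      by (rule conv_lst) (auto intro: ext_cut_mono(2)[OF assms])
    have "Sup (v ` {r. r < p}) \<le> conv (\<lambda>p. if 0 < p then top else bot) v p"
    proof (rule SUP_lst)
      fix r assume "r \<in> {r. r < p}"
      then show "v r \<le> conv (\<lambda>p. if 0 < p then top else bot) v p"
        using conv_ub'[of "p - r" r p "\<lambda>p. if 0 < p then top else bot" v] by simp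
    qed
    then show "v p \<le> conv (\<lambda>p. if 0 < p then top else bot) v p"
      using ext_cutD(4)[OF assms, of p] by simp
  qed
qed


section \<open>Measurable functions\<close>

typedef (overloaded) 'a mext = "{h :: lext \<Rightarrow> 'a::sigma_frame. sigma_frame_hom h}"
  using real_cut_zero[where 'a = 'a] ext_cut_hom unfolding real_cut_def by blast

typedef (overloaded) 'a mreal = "{h :: lreal \<Rightarrow> 'a::sigma_frame. sigma_frame_hom h}"
  using real_cut_zero[where 'a = 'a] real_cut_hom by blast

text \<open>The values \<open>f(p,\<emdash>)\<close> and \<open>f(\<emdash>,q)\<close>.\<close>

definition ext_gt :: "'a::sigma_frame mext \<Rightarrow> rat \<Rightarrow> 'a" where
  "ext_gt f p = Rep_mext f (gt_lext p)"
definition ext_lt :: "'a::sigma_frame mext \<Rightarrow> rat \<Rightarrow> 'a" where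
  "ext_lt f q = Rep_mext f (lt_lext q)"
definition real_gt :: "'a::sigma_frame mreal \<Rightarrow> rat \<Rightarrow> 'a" where
  "real_gt f p = Rep_mreal f (gt_lreal p)"
definition real_lt :: "'a::sigma_frame mreal \<Rightarrow> rat \<Rightarrow> 'a" where
  "real_lt f q = Rep_mreal f (lt_lreal q)"

text \<open>The function with prescribed values on the generators; meaningful only if these
  values satisfy the defining relations.\<close>

definition mext_of :: "(rat \<Rightarrow> 'a::sigma_frame) \<Rightarrow> (rat \<Rightarrow> 'a) \<Rightarrow> 'a mext" where
  "mext_of u v = (THE f. (\<forall>p. ext_gt f p = u p) \<and> (\<forall>q. ext_lt f q = v q))"
definition mreal_of :: "(rat \<Rightarrow> 'a::sigma_frame) \<Rightarrow> (rat \<Rightarrow> 'a) \<Rightarrow> 'a mreal" where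
  "mreal_of u v = (THE f. (\<forall>p. real_gt f p = u p) \<and> (\<forall>q. real_lt f q = v q))"

lemma mext_eqI: "ext_gt f = ext_gt g \<Longrightarrow> ext_lt f = ext_lt g \<Longrightarrow> f = g"
  using Rep_mext[of f] Rep_mext[of g]
  by (intro Rep_mext_inject[THEN iffD1] hom_ext_lext) (auto simp: ext_gt_def ext_lt_def fun_eq_iff)

lemma mreal_eqI: "real_gt f = real_gt g \<Longrightarrow> real_lt f = real_lt g \<Longrightarrow> f = g"
  using Rep_mreal[of f] Rep_mreal[of g]
  by (intro Rep_mreal_inject[THEN iffD1] hom_ext_lreal) (auto simp: real_gt_def real_lt_def fun_eq_iff)

lemma ext_cut_mext: "ext_cut (ext_gt f) (ext_lt f)"
  using hom_ext_cut[of "Rep_mext f"] Rep_mext[of f] by (simp add: ext_gt_def[abs_def] ext_lt_def[abs_def])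

lemma real_cut_mreal: "real_cut (real_gt f) (real_lt f)"
  using hom_real_cut[of "Rep_mreal f"] Rep_mreal[of f] by (simp add: real_gt_def[abs_def] real_lt_def[abs_def])

lemma mext_of:
  assumes "ext_cut u v"
  shows "ext_gt (mext_of u v) = u" "ext_lt (mext_of u v) = v"
proof -
  obtain h where h: "sigma_frame_hom h" "\<And>p. h (gt_lext p) = u p" "\<And>q. h (lt_lext q) = v q"
    using ext_cut_hom[OF assms] by blast
  have ex: "ext_gt (Abs_mext h) = u" "ext_lt (Abs_mext h) = v"
    using h by (auto simp: ext_gt_def ext_lt_def Abs_mext_inverse)
  have "mext_of u v = Abs_mext h"
    unfolding mext_of_def by (rule the_equality) (auto simp: ex fun_eq_iff intro!: mext_eqI)
  with ex show "ext_gt (mext_of u v) = u" "ext_lt (mext_of u v) = v" by simp_all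
qed

lemma mreal_of:
  assumes "real_cut u v"
  shows "real_gt (mreal_of u v) = u" "real_lt (mreal_of u v) = v"
proof -
  obtain h where h: "sigma_frame_hom h" "\<And>p. h (gt_lreal p) = u p" "\<And>q. h (lt_lreal q) = v q"
    using real_cut_hom[OF assms] by blast
  have ex: "real_gt (Abs_mreal h) = u" "real_lt (Abs_mreal h) = v"
    using h by (auto simp: real_gt_def real_lt_def Abs_mreal_inverse)
  have "mreal_of u v = Abs_mreal h"
    unfolding mreal_of_def by (rule the_equality) (auto simp: ex fun_eq_iff intro!: mreal_eqI)
  with ex show "real_gt (mreal_of u v) = u" "real_lt (mreal_of u v) = v" by simp_all
qed

lemma ext_gt_le_imp_lt_le:
  assumes "\<And>p. ext_gt f p \<le> ext_gt g p"
  shows "ext_lt g q \<le> ext_lt f q"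
proof -
  have "ext_lt g s \<le> ext_lt f q" if "s < q" for s
  proof (rule sup_top_le)
    show "sup (ext_gt f s) (ext_lt f q) = top" by (rule ext_cutD(2)[OF ext_cut_mext that])
    have "inf (ext_gt f s) (ext_lt g s) \<le> inf (ext_gt g s) (ext_lt g s)"
      by (intro inf_mono assms order.refl)
    also have "\<dots> = bot" by (rule ext_cutD(1)[OF ext_cut_mext]) simp
    finally show "inf (ext_gt f s) (ext_lt g s) \<le> ext_lt f q" by (simp add: bot.extremum_unique)
  qed simp
  then have "Sup (ext_lt g ` {s. s < q}) \<le> ext_lt f q" by (intro SUP_lst) simp
  then show ?thesis using ext_cutD(4)[OF ext_cut_mext, of g q] by simp
qed

instantiation mext :: (sigma_frame) "{order, zero}"
begin

definition less_eq_mext :: "'a mext \<Rightarrow> 'a mext \<Rightarrow> bool" where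
  "f \<le> g \<longleftrightarrow> (\<forall>p. ext_gt f p \<le> ext_gt g p)"
definition less_mext :: "'a mext \<Rightarrow> 'a mext \<Rightarrow> bool" where
  "less_mext f g \<longleftrightarrow> f \<le> g \<and> \<not> g \<le> f"
definition zero_mext :: "'a mext" where
  "0 = mext_of (\<lambda>p. if p < 0 then top else bot) (\<lambda>q. if 0 < q then top else bot)"

instance
proof
  fix f g h :: "'a mext"
  show "f < g \<longleftrightarrow> f \<le> g \<and> \<not> g \<le> f" by (rule less_mext_def)
  show "f \<le> f" by (simp add: less_eq_mext_def)
  show "f \<le> g \<Longrightarrow> g \<le> h \<Longrightarrow> f \<le> h" unfolding less_eq_mext_def by (meson order.trans)
  show "f \<le> g \<Longrightarrow> g \<le> f \<Longrightarrow> f = g"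
    unfolding less_eq_mext_def
    by (intro mext_eqI ext order.antisym) (auto intro: ext_gt_le_imp_lt_le)
qed

end

lemma zero_mext: "ext_gt 0 p = (if p < 0 then top else bot)" "ext_lt 0 q = (if 0 < q then top else bot)"
  by (simp_all add: zero_mext_def mext_of[OF real_cut_zero[unfolded real_cut_def, THEN conjunct1]])

instantiation mreal :: (sigma_frame) comm_monoid_add
begin

definition zero_mreal :: "'a mreal" where
  "0 = mreal_of (\<lambda>p. if p < 0 then top else bot) (\<lambda>q. if 0 < q then top else bot)"
definition plus_mreal :: "'a mreal \<Rightarrow> 'a mreal \<Rightarrow> 'a mreal" where
  "f + g = mreal_of (conv (real_gt f) (real_gt g)) (conv (real_lt f) (real_lt g))"

lemma plus_mreal:
  "real_gt (f + g) = conv (real_gt f) (real_gt g)" "real_lt (f + g) = conv (real_lt f) (real_lt g)"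
  for f g :: "'a mreal"
  by (simp_all add: plus_mreal_def mreal_of[OF real_cut_conv[OF real_cut_mreal real_cut_mreal]])

lemma zero_mreal:
  "real_gt (0 :: 'a mreal) = (\<lambda>p. if p < 0 then top else bot)"
  "real_lt (0 :: 'a mreal) = (\<lambda>q. if 0 < q then top else bot)"
  by (simp_all add: zero_mreal_def mreal_of[OF real_cut_zero])

instance
proof
  fix f g h :: "'a mreal"
  show "f + g + h = f + (g + h)" by (rule mreal_eqI) (simp_all add: plus_mreal conv_assoc)
  show "f + g = g + f" by (rule mreal_eqI) (simp_all add: plus_mreal conv_commute)
  have "ext_cut (real_gt f) (real_lt f)" using real_cut_mreal[of f] by (simp add: real_cut_def)
  then show "0 + f = f" by (intro mreal_eqI) (simp_all add: plus_mreal zero_mreal conv_zero)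
qed

end

text \<open>Meaningful for \<open>c > 0\<close>.\<close>

definition scale :: "rat \<Rightarrow> 'a::sigma_frame mreal \<Rightarrow> 'a mreal" where
  "scale c f = mreal_of (\<lambda>p. real_gt f (p / c)) (\<lambda>q. real_lt f (q / c))"

lemma scale:
  assumes "0 < c"
  shows "real_gt (scale c f) p = real_gt f (p / c)" "real_lt (scale c f) q = real_lt f (q / c)"
  by (simp_all add: scale_def mreal_of[OF real_cut_scale[OF assms real_cut_mreal]])

text \<open>Meaningful for complemented \<open>a\<close>.\<close>

definition chi :: "'a::sigma_frame \<Rightarrow> 'a mreal" where
  "chi a = mreal_of (\<lambda>p. if p < 0 then top else if p < 1 then a else bot)
                    (\<lambda>q. if q \<le> 0 then bot else if q \<le> 1 then compl_of a else top)"

lemma chi: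
  assumes "complemented a"
  shows "real_gt (chi a) p = (if p < 0 then top else if p < 1 then a else bot)"
    "real_lt (chi a) q = (if q \<le> 0 then bot else if q \<le> 1 then compl_of a else top)"
  by (simp_all add: chi_def mreal_of[OF real_cut_chi[OF compl_of[OF assms]]])

text \<open>The inclusion of the measurable real functions into the measurable extended real functions.\<close>

definition ext_of_mreal :: "'a::sigma_frame mreal \<Rightarrow> 'a mext" where
  "ext_of_mreal f = mext_of (real_gt f) (real_lt f)"

lemma ext_of_mreal:
  "ext_gt (ext_of_mreal f) = real_gt f" "ext_lt (ext_of_mreal f) = real_lt f"
  by (simp_all add: ext_of_mreal_def mext_of[OF real_cut_mreal[unfolded real_cut_def, THEN conjunct1]])

lemma inj_ext_of_mreal: "inj ext_of_mreal"
  by (rule injI) (metis ext_of_mreal mreal_eqI)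

lemma ext_of_mreal_zero: "ext_of_mreal 0 = 0"
  by (rule mext_eqI) (auto simp: ext_of_mreal zero_mreal zero_mext)

lemma range_ext_of_mreal:
  "range ext_of_mreal = {f. Sup (range (ext_gt f)) = top \<and> Sup (range (ext_lt f)) = top}"
proof (intro equalityI subsetI)
  fix f assume "f \<in> range ext_of_mreal"
  then show "f \<in> {f. Sup (range (ext_gt f)) = top \<and> Sup (range (ext_lt f)) = top}"
    by (auto simp: ext_of_mreal real_cut_mreal[unfolded real_cut_def])
next
  fix f :: "'a mext" assume "f \<in> {f. Sup (range (ext_gt f)) = top \<and> Sup (range (ext_lt f)) = top}"
  then have "real_cut (ext_gt f) (ext_lt f)" by (simp add: real_cut_def ext_cut_mext)
  from mreal_of[OF this] have "f = ext_of_mreal (mreal_of (ext_gt f) (ext_lt f))"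
    by (intro mext_eqI) (simp_all add: ext_of_mreal)
  then show "f \<in> range ext_of_mreal" by blast
qed


section \<open>Limits in a partially ordered set\<close>

definition is_join :: "'b::order set \<Rightarrow> 'b \<Rightarrow> bool" where
  "is_join A x \<longleftrightarrow> (\<forall>a\<in>A. a \<le> x) \<and> (\<forall>y. (\<forall>a\<in>A. a \<le> y) \<longrightarrow> x \<le> y)"

definition is_meet :: "'b::order set \<Rightarrow> 'b \<Rightarrow> bool" where
  "is_meet A x \<longleftrightarrow> (\<forall>a\<in>A. x \<le> a) \<and> (\<forall>y. (\<forall>a\<in>A. y \<le> a) \<longrightarrow> y \<le> x)"

text \<open>Sequences are indexed from 1; the value at 0 is ignored. Each predicate asserts
  that all joins and meets involved exist.\<close>

definition has_liminf :: "(nat \<Rightarrow> 'b::order) \<Rightarrow> 'b \<Rightarrow> bool" where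
  "has_liminf F x \<longleftrightarrow> (\<exists>g. (\<forall>n\<ge>1. is_meet {F k |k. k \<ge> n} (g n)) \<and> is_join {g n |n. n \<ge> 1} x)"

definition has_limsup :: "(nat \<Rightarrow> 'b::order) \<Rightarrow> 'b \<Rightarrow> bool" where
  "has_limsup F x \<longleftrightarrow> (\<exists>g. (\<forall>n\<ge>1. is_join {F k |k. k \<ge> n} (g n)) \<and> is_meet {g n |n. n \<ge> 1} x)"

definition has_limit :: "(nat \<Rightarrow> 'b::order) \<Rightarrow> 'b \<Rightarrow> bool" where
  "has_limit F x \<longleftrightarrow> has_liminf F x \<and> has_limsup F x"

end

theory Submission
  imports Defs
begin

text \<open>
  The sets \<open>a\<^sub>k\<close> are chosen greedily: with \<open>S\<^sub>k\<close> the \<open>k\<close>-th partial sum,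
  \<open>a\<^sub>k = {f > S\<^bsub>k-1\<^esub> + 1/k}\<close>, so that \<open>S\<^sub>k \<le> f\<close>. Off \<open>a\<^sub>k\<close> one has \<open>f \<le> S\<^bsub>k-1\<^esub> + 1/k\<close>, and
  on the intersection of \<open>a\<^sub>k\<close> over \<open>N < k \<le> M\<close> the sum \<open>S\<^sub>M\<close> is at least the sum of the
  corresponding \<open>1/k\<close>, which is unbounded in \<open>M\<close>. Hence for \<open>p < r\<close> some \<open>M\<close> satisfies
  \<open>f(r,\<emdash>) \<le> S\<^sub>M(p,\<emdash>)\<close>, and \<open>f\<close> is the join of the increasing sequence \<open>S\<^sub>k\<close>. Since \<open>S\<^sub>k\<close> takes
  finitely many values, \<open>a\<^sub>k\<close> is a finite Boolean combination of the elements \<open>f(r,\<emdash>)\<close>.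
\<close>

section \<open>Complemented elements\<close>

lemma complemented_bot: "complemented (bot :: 'a::bounded_lattice)"
  unfolding complemented_def by (intro exI[of _ top]) simp

lemma complemented_top: "complemented (top :: 'a::bounded_lattice)"
  unfolding complemented_def by (intro exI[of _ bot]) simp

lemma complemented_compl_of:
  fixes a :: "'a::sigma_frame"
  assumes "complemented a"
  shows "complemented (compl_of a)"
  using compl_of[OF assms] unfolding complemented_def
  by (intro exI[of _ a]) (simp add: inf.commute sup.commute)

text \<open>De Morgan's law. With the complements as free variables, exchanging \<open>a\<close>,
  \<open>b\<close> with \<open>a'\<close>, \<open>b'\<close> also settles binary joins.\<close>

lemma compl_pair_inf:
  fixes a b :: "'a::sigma_frame"
  assumes a: "inf a a' = bot" "sup a a' = top" and b: "inf b b' = bot" "sup b b' = top"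
  shows "inf (inf a b) (sup a' b') = bot" "sup (inf a b) (sup a' b') = top"
proof -
  have 1: "inf a' (inf a b) \<le> bot"
    using a(1) by (metis inf.assoc inf.commute inf_bot_right order.refl)
  have 2: "inf b' (inf a b) \<le> bot"
    using b(1) by (metis inf.assoc inf.commute inf_bot_right order.refl)
  show "inf (inf a b) (sup a' b') = bot"
    using inf_sup_le[OF 1 2] by (simp add: inf.commute bot.extremum_unique)
  let ?d = "sup (inf a b) (sup a' b')"
  have "a \<le> ?d"
  proof (rule sup_top_le[OF b(2)])
    show "inf b a \<le> ?d" by (simp add: inf.commute)
    have "b' \<le> ?d" by (simp add: le_supI2)
    then show "inf b' a \<le> ?d" by (rule le_infI1)
  qed
  moreover have "a' \<le> ?d" by (simp add: le_supI2)
  ultimately have "sup a a' \<le> ?d" by (rule sup.boundedI)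
  then show "?d = top" using a(2) by (simp add: top.extremum_unique)
qed

lemma complemented_inf:
  fixes a b :: "'a::sigma_frame"
  assumes "complemented a" "complemented b"
  shows "complemented (inf a b)"
  using assms compl_pair_inf unfolding complemented_def by metis

lemma complemented_sup:
  fixes a b :: "'a::sigma_frame"
  assumes "complemented a" "complemented b"
  shows "complemented (sup a b)"
proof -
  note a = compl_of[OF assms(1)] and b = compl_of[OF assms(2)]
  have "inf (compl_of a) a = bot" "sup (compl_of a) a = top"
    "inf (compl_of b) b = bot" "sup (compl_of b) b = top"
    using a b by (simp_all add: inf.commute sup.commute)
  from compl_pair_inf[OF this] show ?thesis
    unfolding complemented_def
    by (intro exI[of _ "inf (compl_of a) (compl_of b)"]) (simp add: inf.commute sup.commute)
qed

lemma complemented_Sup_finite: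
  fixes A :: "'a::sigma_frame set"
  assumes "finite A" "\<And>a. a \<in> A \<Longrightarrow> complemented a"
  shows "complemented (Sup A)"
  using assms
proof (induction A)
  case empty
  then show ?case by (simp add: Sup_empty_eq complemented_bot)
next
  case (insert x A)
  have c: "countable A" using insert.hyps by (simp add: countable_finite)
  have "Sup (insert x A) = sup x (Sup A)"
  proof (rule order.antisym)
    show "Sup (insert x A) \<le> sup x (Sup A)"
      using c by (intro Sup_lst) (auto intro: le_supI2 Sup_ub)
    show "sup x (Sup A) \<le> Sup (insert x A)"
      using c by (auto intro!: Sup_ub Sup_lst)
  qed
  then show ?case using insert by (simp add: complemented_sup)
qed


section \<open>Adding a multiple of a characteristic function\<close>

text \<open>The second summand takes the values \<open>top\<close>, \<open>a\<close>,
  \<open>bot\<close> on \<open>t < 0\<close>, \<open>0 \<le> t < c\<close>,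
  \<open>c \<le> t\<close>. By monotonicity and relation (3), each of the first two ranges
  contributes one term to the convolution.\<close>

lemma real_gt_add_scale_chi:
  fixes h :: "'a::sigma_frame mreal"
  assumes c: "0 < c" and a: "complemented a"
  shows "real_gt (h + scale c (chi a)) p = sup (real_gt h p) (inf a (real_gt h (p - c)))"
proof -
  let ?u = "real_gt h" and ?w = "real_gt (scale c (chi a))"
  have e: "ext_cut ?u (real_lt h)" using real_cut_mreal[of h] by (simp add: real_cut_def)
  have w: "?w q = (if q < 0 then top else if q < c then a else bot)" for q
    using c by (simp add: scale chi[OF a] divide_less_0_iff)
  have "conv ?u ?w p = sup (?u p) (inf a (?u (p - c)))"
  proof (rule order.antisym)
    show "conv ?u ?w p \<le> sup (?u p) (inf a (?u (p - c)))"
    proof (rule conv_lst)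
      fix s t assume st: "s + t = p"
      consider "t < 0" | "0 \<le> t" "t < c" | "c \<le> t" by linarith
      then show "inf (?u s) (?w t) \<le> sup (?u p) (inf a (?u (p - c)))"
      proof cases
        case 1
        then have "?u s \<le> ?u p" using st by (intro ext_cut_mono(1)[OF e]) simp
        then show ?thesis by (intro le_infI1 le_supI1)
      next
        case 2
        then have "?u s \<le> ?u (p - c)" using st by (intro ext_cut_mono(1)[OF e]) simp
        then have "inf (?u s) (?w t) \<le> inf a (?u (p - c))"
          using 2 by (simp add: w le_infI1)
        then show ?thesis by (rule le_supI2)
      next
        case 3
        then show ?thesis using c by (simp add: w)
      qed
    qed
    have "Sup (?u ` {r. p < r}) \<le> conv ?u ?w p"
    proof (rule SUP_lst)
      fix r assume "r \<in> {r. p < r}"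
      then show "?u r \<le> conv ?u ?w p"
        using conv_ub'[of r "p - r" p ?u ?w] by (simp add: w)
    qed
    then have "?u p \<le> conv ?u ?w p" using ext_cutD(3)[OF e, of p] by simp
    moreover have "inf a (Sup (?u ` {r. p - c < r})) \<le> conv ?u ?w p"
    proof (rule inf_SUP_le')
      fix r assume r: "r \<in> {r. p - c < r}"
      \<comment> \<open>As \<open>p - r < c\<close>, this value is \<open>a\<close> or
        \<open>top\<close>.\<close>
      then have "a \<le> ?w (p - r)" by (auto simp: w)
      then have "inf a (?u r) \<le> inf (?u r) (?w (p - r))" by (simp add: le_infI1)
      also have "\<dots> \<le> conv ?u ?w p" by (rule conv_ub') simp
      finally show "inf a (?u r) \<le> conv ?u ?w p" .
    qed
    then have "inf a (?u (p - c)) \<le> conv ?u ?w p" using ext_cutD(3)[OF e, of "p - c"] by simp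
    ultimately show "sup (?u p) (inf a (?u (p - c))) \<le> conv ?u ?w p" by simp
  qed
  then show ?thesis by (simp add: plus_mreal)
qed


section \<open>The greedy approximation\<close>

text \<open>For \<open>g = f(-,\<emdash>)\<close> and \<open>u = h(-,\<emdash>)\<close>, \<open>excess g c u\<close> stands for \<open>{f > h + c}\<close>.\<close>

definition excess :: "(rat \<Rightarrow> 'a::sigma_frame) \<Rightarrow> rat \<Rightarrow> (rat \<Rightarrow> 'a) \<Rightarrow> 'a" where
  "excess g c u = Sup (range (\<lambda>t. inf (g (t + c)) (compl_of (u t))))"

text \<open>The values \<open>S\<^sub>k(p,\<emdash>)\<close> of the partial sums for the weights \<open>c\<^sub>1, c\<^sub>2, \<dots>\<close>\<close>

primrec greedy :: "(rat \<Rightarrow> 'a::sigma_frame) \<Rightarrow> (nat \<Rightarrow> rat) \<Rightarrow> nat \<Rightarrow> rat \<Rightarrow> 'a" where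
  "greedy g c 0 = (\<lambda>p. if p < 0 then top else bot)"
| "greedy g c (Suc k) = (\<lambda>p. sup (greedy g c k p)
     (inf (excess g (c (Suc k)) (greedy g c k)) (greedy g c k (p - c (Suc k)))))"

text \<open>The existence of \<open>V\<close> says that the function takes finitely many values, all in \<open>V\<close>.\<close>

definition simple_fun :: "(rat \<Rightarrow> 'a::sigma_frame) \<Rightarrow> bool" where
  "simple_fun u \<longleftrightarrow> (\<forall>p. complemented (u p)) \<and> antimono u \<and> (\<forall>p<0. u p = top) \<and>
     (\<exists>V. finite V \<and> (\<forall>q\<ge>0. \<exists>v\<in>V. v \<le> q \<and> u v \<le> u q))"

text \<open>If \<open>f > q + c\<close>, then either \<open>h > q\<close>, or
  \<open>h \<le> q\<close> and the term \<open>t = q\<close> of the join witnesses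
  \<open>f > h + c\<close>.\<close>

lemma excess_ub:
  assumes "simple_fun u"
  shows "g (q + c) \<le> sup (excess g c u) (u q)"
proof (rule sup_top_le)
  show "sup (u q) (compl_of (u q)) = top"
    using assms by (intro compl_of) (simp add: simple_fun_def)
  show "inf (u q) (g (q + c)) \<le> sup (excess g c u) (u q)"
    by (intro le_infI1) simp
  have "inf (g (q + c)) (compl_of (u q)) \<le> excess g c u"
    unfolding excess_def by (rule SUP_ub[of q UNIV "\<lambda>t. inf (g (t + c)) (compl_of (u t))"]) simp
  then show "inf (compl_of (u q)) (g (q + c)) \<le> sup (excess g c u) (u q)"
    by (simp add: inf.commute le_supI1)
qed

text \<open>This keeps the sums below \<open>f\<close>: where \<open>f > t + c\<close>,
  \<open>h \<le> t\<close> and \<open>h > p - c\<close>, necessarily \<open>p < t + c\<close>, so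
  \<open>f > p\<close>.\<close>

lemma inf_excess_le:
  assumes u: "simple_fun u" and g: "antimono g"
  shows "inf (excess g c u) (u (p - c)) \<le> g p"
  unfolding excess_def
proof (rule inf_SUP_le)
  fix t
  show "inf (inf (g (t + c)) (compl_of (u t))) (u (p - c)) \<le> g p"
  proof (cases "p \<le> t + c")
    case True
    then have "g (t + c) \<le> g p" by (rule antimonoD[OF g])
    then show ?thesis by (intro le_infI1)
  next
    case False
    then have "u (p - c) \<le> u t" using u by (intro antimonoD[of u]) (auto simp: simple_fun_def)
    then have "inf (compl_of (u t)) (u (p - c)) \<le> inf (compl_of (u t)) (u t)"
      by (intro inf_mono order.refl)
    also have "\<dots> = bot" using compl_of(1)[of "u t"] u by (simp add: simple_fun_def inf.commute)
    finally show ?thesis by (simp add: inf.assoc bot.extremum_unique)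
  qed
qed

text \<open>The countable join is already attained on the finite set \<open>V\<close>: replacing
  \<open>t \<ge> 0\<close> by a suitable \<open>v \<le> t\<close> only enlarges the term, and a term
  with \<open>t < 0\<close> is \<open>bot\<close>.\<close>

lemma complemented_excess:
  assumes u: "simple_fun u" and g: "antimono g" "\<And>p. complemented (g p)"
  shows "complemented (excess g c u)"
proof -
  let ?e = "\<lambda>t. inf (g (t + c)) (compl_of (u t))"
  have cu: "complemented (u p)" for p using u by (simp add: simple_fun_def)
  obtain V where V: "finite V" "\<And>q. 0 \<le> q \<Longrightarrow> \<exists>v\<in>V. v \<le> q \<and> u v \<le> u q"
    using u unfolding simple_fun_def by blast
  have "excess g c u = Sup (?e ` V)"
  proof (rule order.antisym)
    show "excess g c u \<le> Sup (?e ` V)"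
      unfolding excess_def
    proof (rule SUP_lst)
      fix t
      show "?e t \<le> Sup (?e ` V)"
      proof (cases "t < 0")
        case True
        then have "u t = top" using u by (simp add: simple_fun_def)
        then show ?thesis using compl_of_unique[of top "bot :: 'a"] by simp
      next
        case False
        then obtain v where v: "v \<in> V" "v \<le> t" "u v \<le> u t" using V(2)[of t] by auto
        have "compl_of (u t) \<le> compl_of (u v)"
        proof (rule sup_top_le[OF compl_of(2)[OF cu[of v]]])
          have "inf (u v) (compl_of (u t)) \<le> inf (u t) (compl_of (u t))"
            using v(3) by (intro inf_mono order.refl)
          then show "inf (u v) (compl_of (u t)) \<le> compl_of (u v)"
            using compl_of(1)[OF cu[of t]] by (simp add: bot.extremum_unique)
        qed simp
        moreover have "g (t + c) \<le> g (v + c)" using v(2) by (intro antimonoD[OF g(1)]) simp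
        ultimately have "?e t \<le> ?e v" by (rule inf_mono[rotated])
        also have "\<dots> \<le> Sup (?e ` V)" using v(1) by (rule SUP_ub)
        finally show ?thesis .
      qed
    qed
    show "Sup (?e ` V) \<le> excess g c u"
      unfolding excess_def by (intro SUP_lst SUP_ub) simp
  qed
  then show ?thesis
    using V(1) g(2) by (auto intro!: complemented_Sup_finite complemented_inf complemented_compl_of cu)
qed

lemma simple_fun_zero: "simple_fun (\<lambda>p::rat. if p < 0 then top else (bot :: 'a::sigma_frame))"
  unfolding simple_fun_def
  by (auto simp: complemented_bot complemented_top antimono_def intro!: exI[of _ "{0}"])

text \<open>The new values lie in \<open>V\<close> or in \<open>V\<close> shifted by
  \<open>c\<close>. For \<open>q < c\<close> the shifted factor is \<open>top\<close>, so a point of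
  \<open>V\<close> suffices.\<close>

lemma simple_fun_step:
  fixes u :: "rat \<Rightarrow> 'a::sigma_frame"
  assumes u: "simple_fun u" and a: "complemented a" and c: "0 < c"
  shows "simple_fun (\<lambda>p. sup (u p) (inf a (u (p - c))))" (is "simple_fun ?w")
proof -
  have cu: "complemented (u p)" and top: "p < 0 \<Longrightarrow> u p = top" for p
    using u by (auto simp: simple_fun_def)
  have anti: "p \<le> q \<Longrightarrow> u q \<le> u p" for p q
    using u by (auto simp: simple_fun_def dest: antimonoD)
  obtain V where V: "finite V" "\<And>q. 0 \<le> q \<Longrightarrow> \<exists>v\<in>V. v \<le> q \<and> u v \<le> u q"
    using u unfolding simple_fun_def by blast
  have "\<exists>v\<in>V \<union> (\<lambda>v. v + c) ` V. v \<le> q \<and> ?w v \<le> ?w q" if q: "0 \<le> q" for q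
  proof -
    obtain v where v: "v \<in> V" "v \<le> q" "u v \<le> u q" using V(2)[OF q] by auto
    show ?thesis
    proof (cases "q < c")
      case True
      then have "u (q - c) = top" by (intro top) simp
      moreover have "?w v \<le> sup (u q) a" using v(3) by (intro sup_mono inf.cobounded1)
      ultimately show ?thesis using v by (intro bexI[of _ v]) simp_all
    next
      case False
      then obtain v' where v': "v' \<in> V" "v' \<le> q - c" "u v' \<le> u (q - c)"
        using V(2)[of "q - c"] by auto
      \<comment> \<open>The larger of the two candidates is still at most \<open>q\<close> and
        serves both occurrences of \<open>u\<close> at once.\<close>
      have "u (max v (v' + c)) \<le> u q" "u (max v (v' + c) - c) \<le> u (q - c)"
        by (rule order.trans[OF anti v(3)], simp) (rule order.trans[OF anti v'(3)], simp add: le_diff_eq)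
      then have "?w (max v (v' + c)) \<le> ?w q" by (intro sup_mono inf_mono order.refl)
      moreover have "max v (v' + c) \<in> V \<union> (\<lambda>v. v + c) ` V" using v(1) v'(1) by (auto simp: max_def)
      ultimately show ?thesis using v(2) v'(2) by (intro bexI[of _ "max v (v' + c)"]) auto
    qed
  qed
  moreover have "antimono ?w"
    by (intro antimonoI sup_mono inf_mono order.refl anti) simp_all
  ultimately show ?thesis
    using V(1) a cu top unfolding simple_fun_def
    by (auto intro!: complemented_sup complemented_inf exI[of _ "V \<union> (\<lambda>v. v + c) ` V"])
qed

section \<open>Convergence of the greedy sums from below\<close>

context
  fixes g :: "rat \<Rightarrow> 'a::sigma_frame" and c :: "nat \<Rightarrow> rat"
  assumes g: "antimono g" "\<And>p. complemented (g p)"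
    and g_neg: "\<And>p. p < 0 \<Longrightarrow> g p = top"
    and c_pos: "\<And>i. 0 < c (Suc i)"
begin

lemma simple_fun_greedy: "simple_fun (greedy g c k)"
proof (induction k)
  case 0
  show ?case by (simp add: simple_fun_zero)
next
  case (Suc k)
  then show ?case
    by (simp only: greedy.simps) (rule simple_fun_step[OF Suc complemented_excess[OF Suc g] c_pos])
qed

lemma greedy_le: "greedy g c k p \<le> g p"
proof (induction k arbitrary: p)
  case 0
  show ?case by (simp add: g_neg)
next
  case (Suc k)
  then show ?case using inf_excess_le[OF simple_fun_greedy g(1)] by simp
qed

lemma greedy_antimono: "p \<le> q \<Longrightarrow> greedy g c k q \<le> greedy g c k p"
  using simple_fun_greedy[of k] by (auto simp: simple_fun_def dest: antimonoD)

text \<open>Where \<open>f > r\<close>, as long as the sum has not exceeded \<open>p\<close>, every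
  weight from \<open>N\<close> on is added in full. The start value \<open>q < 0\<close> makes the
  second alternative \<open>top\<close> at \<open>M = N\<close>.\<close>

lemma le_greedy_aux:
  assumes c: "\<And>k. k \<ge> N \<Longrightarrow> c (Suc k) \<le> r - p" and q: "q < 0" and M: "N \<le> M"
  shows "g r \<le> sup (greedy g c M p) (greedy g c M (q + (\<Sum>k=N..<M. c (Suc k))))"
  using M
proof (induction M rule: dec_induct)
  case base
  have "greedy g c N q = top" using q simple_fun_greedy[of N] by (simp add: simple_fun_def)
  then show ?case by simp
next
  case (step M)
  let ?G = "greedy g c M" and ?d = "c (Suc M)" and ?s = "q + (\<Sum>k=N..<M. c (Suc k))"
  let ?a = "excess g ?d ?G" and ?G' = "greedy g c (Suc M)"
  let ?R = "sup (?G' p) (?G' (?s + ?d))"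
  have "?G p \<le> ?R" by (simp add: le_supI1)
  \<comment> \<open>Split at the level \<open>r - ?d\<close>, which is at least \<open>p\<close>
    because the weight is at most \<open>r - p\<close>.\<close>
  have "g r \<le> sup ?a (?G (r - ?d))"
    using excess_ub[OF simple_fun_greedy, of g "r - ?d" ?d M] by simp
  also have "\<dots> \<le> sup ?a (?G p)"
    using c[of M] step.hyps by (intro sup_mono order.refl greedy_antimono) simp
  finally have gr: "g r \<le> sup ?a (?G p)" .
  have "inf ?a (?G ?s) \<le> ?R" by (simp add: le_supI2)
  moreover have "inf (?G p) (?G ?s) \<le> ?R" using \<open>?G p \<le> ?R\<close> by (rule le_infI1)
  ultimately have "inf (sup ?a (?G p)) (?G ?s) \<le> ?R" by (rule inf_sup_le)
  moreover have "inf (?G ?s) (g r) \<le> inf (sup ?a (?G p)) (?G ?s)"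
    using gr by (simp add: le_infI2)
  ultimately have 1: "inf (?G ?s) (g r) \<le> ?R" by (rule order.trans[rotated])
  have 2: "inf (?G p) (g r) \<le> ?R" using \<open>?G p \<le> ?R\<close> by (rule le_infI1)
  have "g r \<le> inf (sup (?G p) (?G ?s)) (g r)" using step.IH by simp
  also have "\<dots> \<le> ?R" by (rule inf_sup_le[OF 2 1])
  also have "?s + ?d = q + (\<Sum>k=N..<Suc M. c (Suc k))" using step.hyps by simp
  finally show ?case .
qed

lemma le_greedy:
  assumes c_lim: "\<And>e. 0 < e \<Longrightarrow> \<exists>N. \<forall>k\<ge>N. c (Suc k) \<le> e"
    and c_div: "\<And>N x. \<exists>M\<ge>N. x \<le> (\<Sum>k=N..<M. c (Suc k))"
    and "p < r"
  shows "\<exists>M\<ge>n. g r \<le> greedy g c M p"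
proof -
  obtain N where N: "\<And>k. k \<ge> N \<Longrightarrow> c (Suc k) \<le> r - p" using c_lim[of "r - p"] \<open>p < r\<close> by auto
  \<comment> \<open>The summand 1 offsets the start value \<open>q = -1\<close> below, so both
    alternatives yield a sum above \<open>p\<close>.\<close>
  obtain M where M: "max n N \<le> M" "p + 1 \<le> (\<Sum>k=max n N..<M. c (Suc k))" using c_div by blast
  have "g r \<le> sup (greedy g c M p) (greedy g c M (- 1 + (\<Sum>k=max n N..<M. c (Suc k))))"
    using M N by (intro le_greedy_aux[of "max n N" r p]) auto
  also have "\<dots> \<le> greedy g c M p" using M by (simp add: greedy_antimono)
  finally show ?thesis using M by auto
qed

text \<open>Identifies the recursion with an actual sum of functions. The \<open>i\<close>-th set is
  chosen from the preceding partial sum, hence \<open>i - 1\<close>.\<close>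

lemma real_gt_greedy_sum:
  "real_gt (\<Sum>i=1..k. scale (c i) (chi (excess g (c i) (greedy g c (i - 1))))) = greedy g c k"
proof (induction k)
  case 0
  show ?case by (simp add: zero_mreal)
next
  case (Suc k)
  have "complemented (excess g (c (Suc k)) (greedy g c k))"
    by (rule complemented_excess[OF simple_fun_greedy g])
  then show ?case using Suc by (simp add: real_gt_add_scale_chi c_pos fun_eq_iff)
qed

end


section \<open>Limits of increasing sequences\<close>

text \<open>The meet of a tail is its first member, and the join of every tail is
  \<open>x\<close>.\<close>

lemma has_limit_increasing:
  fixes F :: "nat \<Rightarrow> 'b::order"
  assumes "mono F" and join: "\<And>n. n \<ge> 1 \<Longrightarrow> is_join {F k |k. k \<ge> n} x"
  shows "has_limit F x"
  unfolding has_limit_def has_liminf_def has_limsup_def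
proof (intro conjI)
  have "is_meet {F k |k. k \<ge> n} (F n)" for n
    using monoD[OF \<open>mono F\<close>] unfolding is_meet_def by blast
  then show "\<exists>g. (\<forall>n\<ge>1. is_meet {F k |k. k \<ge> n} (g n)) \<and> is_join {g n |n. n \<ge> 1} x"
    using join[of 1] by (intro exI[of _ F]) simp
  have "is_meet {x |n::nat. n \<ge> 1} x" by (auto simp: is_meet_def)
  then show "\<exists>g. (\<forall>n\<ge>1. is_join {F k |k. k \<ge> n} (g n)) \<and> is_meet {g n |n. n \<ge> 1} x"
    using join by (intro exI[of _ "\<lambda>_. x"]) simp
qed

section \<open>Divergence of the harmonic series\<close>

lemma harmonic_tail_unbounded:
  fixes x :: rat
  shows "\<exists>M\<ge>N. x \<le> (\<Sum>k=N..<M. 1 / of_nat (Suc k))"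
proof -
  let ?h = "\<lambda>k. 1 / (of_nat (Suc k) :: rat)"
  have "\<exists>M\<ge>N. of_nat n * (1 / 2) \<le> (\<Sum>k=N..<M. ?h k)" for n
  proof (induction n)
    case 0
    show ?case by (intro exI[of _ N]) simp
  next
    case (Suc n)
    then obtain M where M: "N \<le> M" "of_nat n * (1 / 2) \<le> (\<Sum>k=N..<M. ?h k)" by blast
    \<comment> \<open>The block from \<open>M\<close> to \<open>2 * M\<close> has
      \<open>M + 1\<close> terms, each at least \<open>1 / (2 * M + 2)\<close>.\<close>
    have "1 / 2 = (\<Sum>k=M..<2 * M + 1. 1 / (of_nat (2 * M + 2) :: rat))"
      by (simp add: field_simps)
    also have "\<dots> \<le> (\<Sum>k=M..<2 * M + 1. ?h k)"
    proof (rule sum_mono)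
      fix k assume "k \<in> {M..<2 * M + 1}"
      then have "(of_nat (Suc k) :: rat) \<le> of_nat (2 * M + 2)" by (subst of_nat_le_iff) simp
      then show "1 / of_nat (2 * M + 2) \<le> ?h k" by (intro divide_left_mono) auto
    qed
    finally have "1 / 2 \<le> (\<Sum>k=M..<2 * M + 1. ?h k)" .
    moreover have "(\<Sum>k=N..<2 * M + 1. ?h k) = (\<Sum>k=N..<M. ?h k) + (\<Sum>k=M..<2 * M + 1. ?h k)"
      using M(1) by (intro sum.atLeastLessThan_concat[symmetric]) auto
    moreover have "of_nat (Suc n) * (1 / 2) = of_nat n * (1 / 2) + (1 / 2 :: rat)"
      by (simp add: field_simps)
    ultimately show ?case using M by (intro exI[of _ "2 * M + 1"]) linarith
  qed
  moreover obtain n where "2 * x < of_nat n" using reals_Archimedean2 by blast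
  moreover from this have "x \<le> of_nat n * (1 / 2)" by simp
  ultimately show ?thesis by (meson order.trans)
qed

section \<open>The representation with weights \<open>1 / i\<close>\<close>

theorem theorem6p2:
  fixes f :: "'a::sigma_frame mext"
  assumes nonneg: "0 \<le> f"
    and compl: "\<And>r. complemented (ext_gt f r)"
    and join: "\<And>A. A \<subseteq> range (ext_gt f) \<Longrightarrow> countable A \<Longrightarrow> complemented (Sup A)"
  shows "\<exists>a :: nat \<Rightarrow> 'a. (\<forall>i\<ge>1. complemented (a i)) \<and>
    has_limit (\<lambda>k. ext_of_mreal (\<Sum>i=1..k. scale (1 / of_nat i) (chi (a i)))) f"
proof -
  define g where "g = ext_gt f"
  define c :: "nat \<Rightarrow> rat" where "c i = 1 / of_nat i" for i
  define a where "a i = excess g (c i) (greedy g c (i - 1))" for i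
  define F where "F k = ext_of_mreal (\<Sum>i=1..k. scale (c i) (chi (a i)))" for k
  have g1: "antimono g" using ext_cut_mono(1)[OF ext_cut_mext] by (auto simp: g_def antimono_def)
  have g2: "complemented (g p)" for p using compl by (simp add: g_def)
  have g3: "g p = top" if "p < 0" for p
    using nonneg that unfolding less_eq_mext_def g_def
    by (metis zero_mext(1) top.extremum_unique)
  have c: "0 < c (Suc i)" for i by (simp add: c_def)
  note gr = g1 g2 g3 c
  have F: "ext_gt (F k) = greedy g c k" for k
    unfolding F_def a_def ext_of_mreal(1) by (rule real_gt_greedy_sum[of g c, OF gr])
  have c_lim: "\<exists>N. \<forall>k\<ge>N. c (Suc k) \<le> e" if "0 < e" for e
  proof -
    obtain N where N: "1 / e < of_nat N" using reals_Archimedean2 by blast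
    have "c (Suc k) \<le> e" if "k \<ge> N" for k
    proof -
      have "1 / e < of_nat (Suc k)" using N that by (simp add: less_le_trans)
      then show ?thesis using \<open>0 < e\<close> by (simp add: c_def field_simps)
    qed
    then show ?thesis by blast
  qed
  have c_div: "\<exists>M\<ge>N. x \<le> (\<Sum>k=N..<M. c (Suc k))" for N x
    unfolding c_def by (rule harmonic_tail_unbounded)
  have "has_limit F f"
  proof (rule has_limit_increasing)
    show "mono F" by (rule incseq_SucI) (simp add: less_eq_mext_def F)
    fix n
    show "is_join {F k |k. k \<ge> n} f"
      unfolding is_join_def
    proof (intro conjI ballI allI impI)
      fix y assume "y \<in> {F k |k. k \<ge> n}"
      then show "y \<le> f" using greedy_le[of g c, OF gr] by (auto simp: less_eq_mext_def F g_def)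
    next
      fix y assume y: "\<forall>z\<in>{F k |k. k \<ge> n}. z \<le> y"
      have "g r \<le> ext_gt y p" if "p < r" for p r
      proof -
        have "\<exists>M\<ge>n. g r \<le> greedy g c M p"
          by (rule le_greedy[of g c p r n, OF gr c_lim c_div \<open>p < r\<close>])
        then obtain M where M: "n \<le> M" "g r \<le> greedy g c M p" by auto
        then have "F M \<le> y" using y by blast
        then have "greedy g c M p \<le> ext_gt y p" by (simp add: less_eq_mext_def F)
        with M(2) show ?thesis by (rule order.trans)
      qed
      \<comment> \<open>Only levels \<open>r\<close> strictly above \<open>p\<close> are reached by
        partial sums; relation (3) recovers the value of \<open>f\<close> at \<open>p\<close> as
        their join.\<close>
      then have "Sup (g ` {r. p < r}) \<le> ext_gt y p" for p by (intro SUP_lst) simp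
      then show "f \<le> y"
        by (simp add: less_eq_mext_def g_def ext_cutD(3)[OF ext_cut_mext, symmetric])
    qed
  qed
  moreover have "complemented (a i)" for i
    unfolding a_def by (rule complemented_excess[OF simple_fun_greedy[of g c, OF gr] g1 g2])
  ultimately show ?thesis unfolding F_def[abs_def] c_def by (intro exI[of _ a] conjI) auto
qed

end
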